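(* Let $\mu_n$ be the critical Curie--Weiss measure on $\Omega_n=\{\pm1\}^n$ (inverse temperature $\beta=1$, external field $h=0$), and for $\sigma\in\Omega_n$ let $S_n=\sigma_1+\cdots+\sigma_n$ and $W_n=S_n/n^{3/4}$. Then there exists a positive constant $C$ such that for all $n$ large enough and all real $x$ with $0\le x\le n^{1/12}$, $$\left|\frac{\mu_n(\sigma: W_n>x)}{1-F(x)}-1-\frac{G(x)}{\sqrt n}\right|\le \frac{C\,(x^{12}+n^{1/3})}{n},$$ where $$F(x)=\frac{\int_{-\infty}^{x}p_1(t)\,dt}{\int_{-\infty}^{\infty}p_1(t)\,dt},\qquad G(x)=\frac{\int_x^{\infty}p_2(t)\,dt}{\int_x^{\infty}p_1(t)\,dt}-\frac{\int_{-\infty}^{\infty}p_2(t)\,dt}{\int_{-\infty}^{\infty}p_1(t)\,dt},$$ with $$p_1(t)=e^{-t^4/12},\qquad p_2(t)=\left(\frac{t^2}{2}-\frac{t^6}{30}\right)e^{-t^4/12}.$$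
   Context: The Curie--Weiss model with inverse temperature $\beta>0$ and external field $h\in\mathbb{R}$ is the probability measure on $\Omega_n=\{\pm1\}^n$ given by $$\mu_n(\sigma)=Z_n^{-1}\exp\left(\frac{\beta}{n}\sum_{1\le i<j\le n}\sigma_i\sigma_j+\beta h\sum_{i=1}^n\sigma_i\right),\qquad \sigma\in\Omega_n,$$ where $Z_n$ is the normalizing constant. In the critical case $\beta=1$, $h=0$ this is $\mu_n(\sigma)=Z_n^{-1}\exp\left(\frac1n\sum_{1\le i<j\le n}\sigma_i\sigma_j\right)$. *)

theory Defs
  imports "HOL-Probability.Probability"
begin

definition Omega :: "nat \<Rightarrow> (nat \<Rightarrow> real) set" where
  "Omega n = {1..n} \<rightarrow>\<^sub>E {-1, 1}"

definition cw_weight :: "real \<Rightarrow> real \<Rightarrow> nat \<Rightarrow> (nat \<Rightarrow> real) \<Rightarrow> real" where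
  "cw_weight \<beta> h n \<sigma> =
     exp (\<beta> / real n * (\<Sum>(i, j)\<in>{(i, j). 1 \<le> i \<and> i < j \<and> j \<le> n}. \<sigma> i * \<sigma> j)
          + \<beta> * h * (\<Sum>i = 1..n. \<sigma> i))"

definition cw_Z :: "real \<Rightarrow> real \<Rightarrow> nat \<Rightarrow> real" where
  "cw_Z \<beta> h n = (\<Sum>\<sigma>\<in>Omega n. cw_weight \<beta> h n \<sigma>)"

definition curie_weiss :: "real \<Rightarrow> real \<Rightarrow> nat \<Rightarrow> (nat \<Rightarrow> real) measure" where
  "curie_weiss \<beta> h n =
     point_measure (Omega n) (\<lambda>\<sigma>. ennreal (cw_weight \<beta> h n \<sigma> / cw_Z \<beta> h n))"

definition S :: "nat \<Rightarrow> (nat \<Rightarrow> real) \<Rightarrow> real" where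
  "S n \<sigma> = (\<Sum>i = 1..n. \<sigma> i)"

definition W :: "nat \<Rightarrow> (nat \<Rightarrow> real) \<Rightarrow> real" where
  "W n \<sigma> = S n \<sigma> / real n powr (3 / 4)"

definition p1 :: "real \<Rightarrow> real" where
  "p1 t = exp (- (t ^ 4) / 12)"

definition p2 :: "real \<Rightarrow> real" where
  "p2 t = (t\<^sup>2 / 2 - t ^ 6 / 30) * exp (- (t ^ 4) / 12)"

definition F :: "real \<Rightarrow> real" where
  "F x = (LBINT t:{..x}. p1 t) / (LBINT t. p1 t)"

definition G :: "real \<Rightarrow> real" where
  "G x = (LBINT t:{x..}. p2 t) / (LBINT t:{x..}. p1 t)
         - (LBINT t. p2 t) / (LBINT t. p1 t)"

lemma finite_Omega: "finite (Omega n)"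
  by (auto simp: Omega_def intro: finite_PiE)

lemma Omega_nonempty: "Omega n \<noteq> {}"
  by (auto simp: Omega_def PiE_eq_empty_iff)

lemma cw_Z_pos: "cw_Z \<beta> h n > 0"
  unfolding cw_Z_def
  by (intro sum_pos finite_Omega Omega_nonempty) (simp add: cw_weight_def)

lemma prob_space_curie_weiss: "prob_space (curie_weiss \<beta> h n)"
proof
  have "(\<Sum>\<sigma>\<in>Omega n. cw_weight \<beta> h n \<sigma> / cw_Z \<beta> h n) = 1"
    using cw_Z_pos[of \<beta> h n] by (simp add: sum_divide_distrib[symmetric] cw_Z_def)
  moreover have "cw_weight \<beta> h n \<sigma> / cw_Z \<beta> h n \<ge> 0" for \<sigma>
    using cw_Z_pos[of \<beta> h n] by (simp add: cw_weight_def)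
  ultimately show "emeasure (curie_weiss \<beta> h n) (space (curie_weiss \<beta> h n)) = 1"
    by (simp add: curie_weiss_def space_point_measure emeasure_point_measure_finite
        finite_Omega sum_ennreal)
qed

end

theory Submission
  imports Defs
begin

text \<open>Since the spins are signs, the pair interaction is $(S_n^2-n)/2$, so the number \<open>j\<close> of
plus spins has a law proportional to the binomial coefficient times $\exp((2j-n)^2/(2n))$.  At
the critical temperature this factor cancels the Gaussian decay of the binomial coefficient,
and what is left lives on the scale $t=(2j-n)/n^{3/4}$: relative to its value in the centre,
the weight is $p_1(t)+p_2(t)/\sqrt n$ with an error of relative size $(1+t^{12})/n$
(\<open>local_limit\<close>).  Stirling's formula is avoided: only ratios to the central weight matter,
the logarithm of the ratio of neighbouring binomial coefficients is $-2\,\mathrm{artanh}$ of an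
explicit number, and summing its Taylor expansion from the centre gives the exponent.  The
error bound holds for all nodes $t\ge 0$, because beyond $t=n^{1/12}$ it exceeds the leading
term, so there the crude bound \<open>cw_term_upper\<close> on the weights is enough.

The scaled tail sum is the integral of a step function of mesh $2n^{-3/4}$, which is compared
pointwise with $p_1+p_2/\sqrt n$ (\<open>step_fun_approx\<close>).  Moving a point \<open>s\<close> by one mesh width
costs a relative error of order $n^{-3/4}(1+s^3)$ as long as $s\le n^{1/12}$, and this is at most a
multiple of $(s^{12}+n^{1/3})/n$; the term
$n^{1/3}$ of the theorem thus stems from the lattice.  To return from pointwise errors to
an error relative to the tail integral one needs that the moments of $p_1$ conditioned to
$[x,\infty)$ are $O(1+x^m)$ (\<open>tail_moment_le\<close>).

The partition function is twice the tail sum at \<open>0\<close>, up to one central atom.  Dividing the two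
expansions (\<open>ratio_expansion\<close>) leaves the difference of their first-order coefficients, which
is \<open>G\<close>.\<close>

section \<open>Tail integrals of the quartic density\<close>

lemma p1_pos [simp]: "p1 t > 0"
  by (simp add: p1_def)

lemma p1_nonneg [simp]: "p1 t \<ge> 0"
  by (simp add: p1_def)

lemma p1_antimono:
  assumes "0 \<le> s" "s \<le> t"
  shows "p1 t \<le> p1 s"
  using power_mono[OF assms(2,1), of 4] by (simp add: p1_def)

lemma borel_measurable_p1 [measurable]: "p1 \<in> borel_measurable borel"
  unfolding p1_def[abs_def] by measurable

text \<open>Since $t^4/12\ge t^2/2-3/4$, the density is dominated by a Gaussian one, whose moments exist.\<close>

lemma integrable_power_p1: "integrable lborel (\<lambda>t. t ^ m * p1 t)"
proof (rule Bochner_Integration.integrable_bound)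
  let ?K = "sqrt (2 * pi) * exp (3/4)"
  show "integrable lborel (\<lambda>t. ?K * (std_normal_density t * t ^ m))"
    by (intro integrable_mult_right integrable_std_normal_moment)
  show "AE t in lborel. norm (t ^ m * p1 t) \<le> norm (?K * (std_normal_density t * t ^ m))"
  proof (rule AE_I2)
    fix t :: real
    have "0 \<le> (t\<^sup>2 - 3)\<^sup>2" by simp
    then have "- (t ^ 4) / 12 \<le> 3/4 + (- (t\<^sup>2) / 2)"
      by (simp add: power2_eq_square power4_eq_xxxx algebra_simps)
    then have "p1 t \<le> exp (3/4 + (- (t\<^sup>2) / 2))"
      unfolding p1_def by (subst exp_le_cancel_iff)
    also have "\<dots> = ?K * std_normal_density t"
      unfolding std_normal_density_def exp_add by simp
    finally have "\<bar>t ^ m\<bar> * p1 t \<le> \<bar>t ^ m\<bar> * (?K * std_normal_density t)"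
      by (rule mult_left_mono) simp
    then show "norm (t ^ m * p1 t) \<le> norm (?K * (std_normal_density t * t ^ m))"
      by (simp add: abs_mult mult_ac)
  qed
qed simp

lemma set_integrable_power_p1:
  assumes "A \<in> sets borel"
  shows "set_integrable lborel A (\<lambda>t. t ^ m * p1 t)"
  unfolding set_integrable_def
  using integrable_mult_indicator[of A lborel, OF _ integrable_power_p1] assms by simp

lemma set_integrable_p1:
  assumes "A \<in> sets borel"
  shows "set_integrable lborel A p1"
  using set_integrable_power_p1[OF assms, of 0] by simp

lemma set_integral_p1_mono_set:
  assumes "A \<subseteq> B" "A \<in> sets borel" "B \<in> sets borel"
  shows "(LBINT t:A. p1 t) \<le> (LBINT t:B. p1 t)"
  unfolding set_lebesgue_integral_def
proof (rule integral_mono)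
  show "integrable lborel (\<lambda>t. indicator A t *\<^sub>R p1 t)" "integrable lborel (\<lambda>t. indicator B t *\<^sub>R p1 t)"
    using set_integrable_p1[OF assms(2)] set_integrable_p1[OF assms(3)] by (simp_all add: set_integrable_def)
qed (use assms(1) in \<open>auto simp: indicator_def\<close>)

lemma p2_eq: "p2 t = 1/2 * (t ^ 2 * p1 t) - 1/30 * (t ^ 6 * p1 t)"
  by (simp add: p2_def p1_def algebra_simps)

lemma set_integrable_p2:
  assumes "A \<in> sets borel"
  shows "set_integrable lborel A p2"
  unfolding p2_eq
  by (intro set_integral_diff(1) set_integrable_mult_right set_integrable_power_p1 assms)

lemma tail_p1_pos:
  "(LBINT t:{x..}. p1 t) > 0"
proof -
  have "0 < (LBINT t:{x..x+1}. exp (- ((\<bar>x\<bar> + 1) ^ 4) / 12))"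
    by (simp add: set_lebesgue_integral_def)
  also have "\<dots> \<le> (LBINT t:{x..x+1}. p1 t)"
  proof (rule set_integral_mono)
    fix t assume t: "t \<in> {x..x+1}"
    then have "\<bar>t\<bar> \<le> \<bar>x\<bar> + 1" by auto
    then have "\<bar>t\<bar> ^ 4 \<le> (\<bar>x\<bar> + 1) ^ 4" by (rule power_mono) simp
    then show "exp (- ((\<bar>x\<bar> + 1) ^ 4) / 12) \<le> p1 t" by (simp add: p1_def)
  qed (use set_integrable_p1[of "{x..x+1}"] in \<open>auto simp: set_integrable_def intro!: integrable_mult_right\<close>)
  also have "\<dots> \<le> (LBINT t:{x..}. p1 t)"
    by (rule set_integral_p1_mono_set) auto
  finally show ?thesis .
qed

text \<open>The density loses at most a factor $e$ on an interval of length $(1+x)^{-3}$ to the right of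
\<open>x\<close>, because the fourth power grows there by at most 4.\<close>

lemma p1_le_tail:
  assumes "x \<ge> 0"
  shows "p1 x \<le> exp 1 * (1 + x) ^ 3 * (LBINT t:{x..}. p1 t)"
proof -
  define h where "h = 1 / (1 + x) ^ 3"
  have h: "0 < h" "h \<le> 1" using assms by (auto simp: h_def)
  have "h * (p1 x * exp (- 1)) = (LBINT t:{x..x+h}. p1 x * exp (- 1))"
    using h by (simp add: set_lebesgue_integral_def)
  also have "\<dots> \<le> (LBINT t:{x..x+h}. p1 t)"
  proof (rule set_integral_mono)
    show "set_integrable lborel {x..x+h} (\<lambda>t. p1 x * exp (- 1))"
      using h by (auto simp: set_integrable_def intro!: integrable_mult_left)
    fix t assume t: "t \<in> {x..x+h}"
    define d where "d = t - x"
    have d: "0 \<le> d" "d \<le> h" "t = x + d" using t by (auto simp: d_def)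
    have "t ^ 4 - x ^ 4 = d * (t ^ 3 + t ^ 2 * x + t * x ^ 2 + x ^ 3)"
      unfolding d_def by algebra
    also have "\<dots> \<le> h * ((1+x)^3 + (1+x)^2 * (1+x) + (1+x) * (1+x)^2 + (1+x)^3)"
      using assms d h
      by (intro mult_mono add_mono power_mono add_nonneg_nonneg mult_nonneg_nonneg) auto
    also have "\<dots> = h * (4 * (1 + x) ^ 3)" by algebra
    also have "\<dots> = 4" using assms by (simp add: h_def)
    finally have "- (x ^ 4) / 12 + (- 1) \<le> - (t ^ 4) / 12" by simp
    then show "p1 x * exp (- 1) \<le> p1 t"
      unfolding p1_def by (simp flip: exp_add)
  qed (auto intro: set_integrable_p1)
  also have "\<dots> \<le> (LBINT t:{x..}. p1 t)"
    by (rule set_integral_p1_mono_set) auto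
  finally have "h * (p1 x * exp (- 1)) \<le> (LBINT t:{x..}. p1 t)" .
  from mult_left_mono[OF this, of "exp 1 * (1 + x) ^ 3"]
  have "exp 1 * (1 + x) ^ 3 * (h * (p1 x * exp (- 1))) \<le> exp 1 * (1 + x) ^ 3 * (LBINT t:{x..}. p1 t)"
    using assms by simp
  moreover have "exp 1 * (1 + x) ^ 3 * (h * (p1 x * exp (- 1))) = p1 x"
    using assms by (simp add: h_def exp_minus field_simps)
  ultimately show ?thesis by simp
qed

lemma LBINT_tail_shift:
  fixes f :: "real \<Rightarrow> real"
  shows "(LBINT t:{x..}. f t) = (LBINT s:{0..}. f (x + s))"
proof -
  have "(LBINT t:{x..}. f t) = (LBINT s. indicator {x..} (x + 1 * s) *\<^sub>R f (x + 1 * s))"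
    unfolding set_lebesgue_integral_def
    by (subst lborel_integral_real_affine[of 1 _ x]) auto
  also have "\<dots> = (LBINT s:{0..}. f (x + s))"
    unfolding set_lebesgue_integral_def
    by (rule Bochner_Integration.integral_cong) (auto simp: indicator_def)
  finally show ?thesis .
qed

lemma set_integrable_shift_p1:
  "set_integrable lborel {0..} (\<lambda>s. s ^ m * p1 (x + s))" if "x \<ge> 0"
proof (rule set_integrable_bound[OF set_integrable_power_p1[of "{0..}" m]])
  show "AE s in lborel. s \<in> {0..} \<longrightarrow> norm (s ^ m * p1 (x + s)) \<le> norm (s ^ m * p1 s)"
    using that by (auto simp: abs_mult intro!: mult_left_mono p1_antimono)
qed (auto simp: set_borel_measurable_def)

text \<open>Conditioned to $[x,\infty)$, the overshoot $t-x$ is stochastically smaller than for $x=0$: the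
likelihood ratio \<open>g\<close> of the two laws is decreasing.  Hence $(s^m-M)(g(s)-g(r))\le 0$ when
$r^m=M$, and integrating this against $p_1$ with the choice of $M$ as the moment at $x=0$ gives the
claim.\<close>

lemma shifted_moment_le:
  assumes x: "x \<ge> 0" and m: "m > 0"
  defines "M \<equiv> (LBINT s:{0..}. s ^ m * p1 s) / (LBINT s:{0..}. p1 s)"
  shows "(LBINT s:{0..}. s ^ m * p1 (x + s)) \<le> M * (LBINT s:{0..}. p1 (x + s))"
proof -
  have M0: "M \<ge> 0" unfolding M_def set_lebesgue_integral_def
    by (intro divide_nonneg_nonneg Bochner_Integration.integral_nonneg) (auto simp: indicator_def)
  define r where "r = root m M"
  have r: "r \<ge> 0" "r ^ m = M" using M0 m by (auto simp: r_def)
  define g where "g = (\<lambda>s. p1 (x + s) / p1 s)"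
  have g_eq: "g s = exp (- (4 * x^3 * s + 6 * x^2 * s^2 + 4 * x * s^3 + x^4) / 12)" for s
  proof -
    have "- ((x + s) ^ 4) / 12 - (- (s ^ 4) / 12)
        = - (4 * x^3 * s + 6 * x^2 * s^2 + 4 * x * s^3 + x^4) / 12" by algebra
    then show ?thesis unfolding g_def p1_def by (simp flip: exp_diff)
  qed
  have g_mono: "g t \<le> g s" if "0 \<le> s" "s \<le> t" for s t
  proof -
    have "4 * x^3 * s + 6 * x^2 * s^2 + 4 * x * s^3 + x^4 \<le> 4 * x^3 * t + 6 * x^2 * t^2 + 4 * x * t^3 + x^4"
      using x that by (intro add_mono mult_left_mono power_mono) auto
    then show ?thesis unfolding g_eq by simp
  qed
  have int: "set_integrable lborel {0..} (\<lambda>s. s ^ m * p1 (x + s) - M * p1 (x + s))"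
    "set_integrable lborel {0..} (\<lambda>s. g r * (s ^ m * p1 s) - g r * M * p1 s)"
    using set_integrable_shift_p1[OF x, of m] set_integrable_shift_p1[OF x, of 0]
    by (auto intro!: set_integral_diff set_integrable_mult_right set_integrable_power_p1 set_integrable_p1)
  have "(LBINT s:{0..}. s ^ m * p1 (x + s)) - M * (LBINT s:{0..}. p1 (x + s))
     = (LBINT s:{0..}. s ^ m * p1 (x + s) - M * p1 (x + s))"
    using set_integrable_shift_p1[OF x, of m] set_integrable_shift_p1[OF x, of 0]
    by (subst set_integral_diff(2)) auto
  also have "\<dots> \<le> (LBINT s:{0..}. g r * (s ^ m * p1 s) - g r * M * p1 s)"
  proof (rule set_integral_mono[OF int])
    fix s :: real assume s: "s \<in> {0..}"
    have "(s ^ m - M) * g s \<le> (s ^ m - M) * g r"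
    proof (cases "r \<le> s")
      case True
      then have "M \<le> s ^ m" using r power_mono[of r s m] by simp
      then show ?thesis using g_mono[OF r(1) True] by (intro mult_left_mono) auto
    next
      case False
      then have "s ^ m \<le> M" using r s power_mono[of s r m] by simp
      then show ?thesis using g_mono[of s r] s False by (intro mult_left_mono_neg) auto
    qed
    then have "(s ^ m - M) * g s * p1 s \<le> (s ^ m - M) * g r * p1 s"
      by (rule mult_right_mono) simp
    moreover have "g s * p1 s = p1 (x + s)"
      using p1_pos[of s, THEN less_imp_neq] by (simp add: g_def)
    ultimately show "s ^ m * p1 (x + s) - M * p1 (x + s) \<le> g r * (s ^ m * p1 s) - g r * M * p1 s"
      by (simp add: left_diff_distrib mult.assoc) (simp add: mult_ac)
  qed
  also have "\<dots> = g r * ((LBINT s:{0..}. s ^ m * p1 s) - M * (LBINT s:{0..}. p1 s))"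
    by (subst set_integral_diff(2))
       (auto intro!: set_integrable_mult_right set_integrable_power_p1 set_integrable_p1
         simp: right_diff_distrib mult.assoc)
  also have "\<dots> = 0"
    using tail_p1_pos[of 0] by (simp add: M_def)
  finally show ?thesis by simp
qed

lemma tail_moment_le:
  "\<exists>C\<ge>0. \<forall>x\<ge>0. (LBINT t:{x..}. t ^ m * p1 t) \<le> C * (1 + x ^ m) * (LBINT t:{x..}. p1 t)"
proof (cases "m = 0")
  case True then show ?thesis using tail_p1_pos by (intro exI[of _ 1]) (auto simp: less_imp_le)
next
  case False
  then have m: "m > 0" by simp
  define M where "M = (LBINT s:{0..}. s ^ m * p1 s) / (LBINT s:{0..}. p1 s)"
  have M0: "M \<ge> 0" unfolding M_def set_lebesgue_integral_def
    by (intro divide_nonneg_nonneg Bochner_Integration.integral_nonneg) (auto simp: indicator_def)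
  show ?thesis
  proof (intro exI[of _ "2 ^ m * (1 + M)"] conjI allI impI)
    fix x :: real assume x: "x \<ge> 0"
    have p: "(x + s) ^ m \<le> 2 ^ m * (x ^ m + s ^ m)" if "s \<ge> 0" for s
    proof -
      have "(x + s) ^ m \<le> (2 * max x s) ^ m" using x that by (intro power_mono) auto
      also have "\<dots> = 2 ^ m * max x s ^ m" by (rule power_mult_distrib)
      also have "\<dots> \<le> 2 ^ m * (x ^ m + s ^ m)" using x that by (auto simp: max_def)
      finally show ?thesis .
    qed
    have i0: "set_integrable lborel {0..} (\<lambda>s. p1 (x + s))"
      using set_integrable_shift_p1[OF x, of 0] by simp
    have "(LBINT t:{x..}. t ^ m * p1 t) = (LBINT s:{0..}. (x + s) ^ m * p1 (x + s))"
      by (rule LBINT_tail_shift)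
    also have "\<dots> \<le> (LBINT s:{0..}. 2 ^ m * x ^ m * p1 (x + s) + 2 ^ m * (s ^ m * p1 (x + s)))"
    proof (rule set_integral_mono)
      show "set_integrable lborel {0..} (\<lambda>s. 2 ^ m * x ^ m * p1 (x + s) + 2 ^ m * (s ^ m * p1 (x + s)))"
        by (intro set_integral_add(1) set_integrable_mult_right set_integrable_shift_p1[OF x] i0)
      then show "set_integrable lborel {0..} (\<lambda>s. (x + s) ^ m * p1 (x + s))"
      proof (rule set_integrable_bound)
        show "AE s in lborel. s \<in> {0..} \<longrightarrow> norm ((x + s) ^ m * p1 (x + s))
           \<le> norm (2 ^ m * x ^ m * p1 (x + s) + 2 ^ m * (s ^ m * p1 (x + s)))"
        proof (rule AE_I2, rule impI)
          fix s :: real assume "s \<in> {0..}"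
          then show "norm ((x + s) ^ m * p1 (x + s))
           \<le> norm (2 ^ m * x ^ m * p1 (x + s) + 2 ^ m * (s ^ m * p1 (x + s)))"
            using mult_right_mono[OF p[of s], of "p1 (x + s)"] x by (simp add: algebra_simps)
        qed
      qed (auto simp: set_borel_measurable_def)
      fix s :: real assume "s \<in> {0..}"
      then show "(x + s) ^ m * p1 (x + s) \<le> 2 ^ m * x ^ m * p1 (x + s) + 2 ^ m * (s ^ m * p1 (x + s))"
        using mult_right_mono[OF p[of s], of "p1 (x + s)"] by (simp add: algebra_simps)
    qed
    also have "\<dots> = 2 ^ m * x ^ m * (LBINT s:{0..}. p1 (x + s)) + 2 ^ m * (LBINT s:{0..}. s ^ m * p1 (x + s))"
      by (subst set_integral_add(2)) (auto intro!: set_integrable_mult_right set_integrable_shift_p1[OF x] i0)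
    also have "\<dots> \<le> 2 ^ m * x ^ m * (LBINT s:{0..}. p1 (x + s)) + 2 ^ m * (M * (LBINT s:{0..}. p1 (x + s)))"
      unfolding M_def by (intro add_left_mono mult_left_mono shifted_moment_le[OF x m]) auto
    also have "\<dots> = 2 ^ m * (x ^ m + M) * (LBINT t:{x..}. p1 t)"
      by (simp add: LBINT_tail_shift[of x] algebra_simps)
    also have "\<dots> \<le> 2 ^ m * (1 + M) * (1 + x ^ m) * (LBINT t:{x..}. p1 t)"
    proof (rule mult_right_mono)
      have "x ^ m + M \<le> (1 + M) * (1 + x ^ m)"
        using M0 x by (simp add: algebra_simps)
      from mult_left_mono[OF this, of "2 ^ m"]
      show "2 ^ m * (x ^ m + M) \<le> 2 ^ m * (1 + M) * (1 + x ^ m)" by (simp add: mult.assoc)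
    qed (use tail_p1_pos[of x] in simp)
    finally show "(LBINT t:{x..}. t ^ m * p1 t) \<le> 2 ^ m * (1 + M) * (1 + x ^ m) * (LBINT t:{x..}. p1 t)" .
  qed (use M0 in simp)
qed

section \<open>Increments of the logarithm of the weights\<close>

text \<open>The function $\ln\frac{1+v}{1-v}$ is $2\,\mathrm{artanh}\,v$.  Its derivative is a geometric
series in $v^2$, cut off here with explicit remainder; integrating gives the Taylor bounds.\<close>

lemma atanh_derivative_split:
  fixes x :: real
  assumes "0 \<le> x" "x < 1"
  shows "1 / (1 + x) + 1 / (1 - x) = 2 + 2 * x ^ 2 + 2 * x ^ 4 / ((1 + x) * (1 - x))"
    and "1 / (1 + x) + 1 / (1 - x) = 2 + 2 * x ^ 2 + 2 * x ^ 4 + 2 * x ^ 6 / ((1 + x) * (1 - x))"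
proof -
  define D where "D = (1 + x) * (1 - x)"
  have D: "D \<noteq> 0" using assms by (simp add: D_def)
  have s: "1 / (1 + x) + 1 / (1 - x) = 2 / D"
    using assms by (simp add: D_def add_frac_eq)
  have "2 * x ^ 4 = 2 - (2 + 2 * x ^ 2) * D" "2 * x ^ 6 = 2 - (2 + 2 * x ^ 2 + 2 * x ^ 4) * D"
    unfolding D_def by algebra+
  then have "2 * x ^ 4 / D = 2 / D - (2 + 2 * x ^ 2)" "2 * x ^ 6 / D = 2 / D - (2 + 2 * x ^ 2 + 2 * x ^ 4)"
    using D by (simp_all add: diff_divide_distrib)
  then show "1 / (1 + x) + 1 / (1 - x) = 2 + 2 * x ^ 2 + 2 * x ^ 4 / ((1 + x) * (1 - x))"
    and "1 / (1 + x) + 1 / (1 - x) = 2 + 2 * x ^ 2 + 2 * x ^ 4 + 2 * x ^ 6 / ((1 + x) * (1 - x))"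
    unfolding s D_def[symmetric] by simp_all
qed

lemma atanh_lower:
  fixes v :: real
  assumes "0 \<le> v" "v < 1"
  shows "2 * v + 2/3 * v ^ 3 \<le> ln ((1 + v) / (1 - v))"
proof -
  let ?f = "\<lambda>v::real. ln (1 + v) - ln (1 - v) - 2 * v - 2/3 * v ^ 3"
  have "?f 0 \<le> ?f v"
  proof (rule DERIV_nonneg_imp_nondecreasing[OF assms(1)])
    fix x assume x: "0 \<le> x" "x \<le> v"
    then have x1: "x < 1" using assms by simp
    have "DERIV ?f x :> 1 / (1 + x) + 1 / (1 - x) - 2 - 2 * x ^ 2"
      using x x1 by (auto intro!: derivative_eq_intros simp: power2_eq_square)
    moreover have "1 / (1 + x) + 1 / (1 - x) - 2 - 2 * x ^ 2 = 2 * x ^ 4 / ((1 + x) * (1 - x))"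
      using atanh_derivative_split(1)[of x] x x1 by simp
    moreover have "2 * x ^ 4 / ((1 + x) * (1 - x)) \<ge> 0" using x x1 by simp
    ultimately show "\<exists>y. DERIV ?f x :> y \<and> 0 \<le> y" by auto
  qed
  then show ?thesis using assms by (simp add: ln_div)
qed

lemma atanh_expansion:
  fixes v :: real
  assumes "0 \<le> v" "v \<le> 1/2"
  shows "2 * v + 2/3 * v ^ 3 + 2/5 * v ^ 5 \<le> ln ((1 + v) / (1 - v))"
    and "ln ((1 + v) / (1 - v)) \<le> 2 * v + 2/3 * v ^ 3 + 2/5 * v ^ 5 + v ^ 7"
proof -
  let ?f = "\<lambda>v::real. ln (1 + v) - ln (1 - v) - 2 * v - 2/3 * v ^ 3 - 2/5 * v ^ 5"
  have d: "DERIV ?f x :> 2 * x ^ 6 / ((1 + x) * (1 - x))" if x: "0 \<le> x" "x \<le> v" for x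
  proof -
    have "DERIV ?f x :> 1 / (1 + x) + 1 / (1 - x) - 2 - 2 * x ^ 2 - 2 * x ^ 4"
      using x assms by (auto intro!: derivative_eq_intros simp: power2_eq_square)
    moreover have "1 / (1 + x) + 1 / (1 - x) - 2 - 2 * x ^ 2 - 2 * x ^ 4 = 2 * x ^ 6 / ((1 + x) * (1 - x))"
      using atanh_derivative_split(2)[of x] x assms by simp
    ultimately show ?thesis by simp
  qed
  have "?f 0 \<le> ?f v"
  proof (rule DERIV_nonneg_imp_nondecreasing[OF assms(1)])
    fix x assume x: "0 \<le> x" "x \<le> v"
    then have "2 * x ^ 6 / ((1 + x) * (1 - x)) \<ge> 0" using assms by simp
    with d[OF x] show "\<exists>y. DERIV ?f x :> y \<and> 0 \<le> y" by blast
  qed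
  then show "2 * v + 2/3 * v ^ 3 + 2/5 * v ^ 5 \<le> ln ((1 + v) / (1 - v))"
    using assms by (simp add: ln_div)
  have "0 ^ 7 - ?f 0 \<le> v ^ 7 - ?f v"
  proof (rule DERIV_nonneg_imp_nondecreasing[OF assms(1)])
    fix x assume x: "0 \<le> x" "x \<le> v"
    have dd: "DERIV (\<lambda>v. v ^ 7 - ?f v) x :> 7 * x ^ 6 - 2 * x ^ 6 / ((1 + x) * (1 - x))"
      by (rule DERIV_diff[OF _ d[OF x]]) (auto intro!: derivative_eq_intros)
    have "x * x \<le> 1/2 * (1/2)" using x assms by (intro mult_mono) auto
    then have "2 \<le> 7 * ((1 + x) * (1 - x))" by (simp add: algebra_simps)
    moreover have "0 < (1 + x) * (1 - x)" using x assms by simp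
    ultimately have "2 / ((1 + x) * (1 - x)) \<le> 7" by (simp only: pos_divide_le_eq mult_ac)
    then have "2 / ((1 + x) * (1 - x)) * x ^ 6 \<le> 7 * x ^ 6" by (rule mult_right_mono) simp
    then have "0 \<le> 7 * x ^ 6 - 2 * x ^ 6 / ((1 + x) * (1 - x))" by simp
    with dd show "\<exists>y. DERIV (\<lambda>v. v ^ 7 - ?f v) x :> y \<and> 0 \<le> y" by blast
  qed
  then show "ln ((1 + v) / (1 - v)) \<le> 2 * v + 2/3 * v ^ 3 + 2/5 * v ^ 5 + v ^ 7"
    using assms by (simp add: ln_div)
qed

text \<open>The ratio of neighbouring binomial coefficients produces powers of $m/(N+1)$, while the limit
profile is written with $m/N$; by Bernoulli's inequality the difference is of relative order
$1/N$.\<close>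

lemma power_shift_bounds:
  fixes m N :: real
  assumes "0 \<le> m" "1 \<le> N"
  shows "(m / (N + 1)) ^ p \<le> (m / N) ^ p"
    and "(m / N) ^ p - (m / (N + 1)) ^ p \<le> real p * (m / N) ^ p / N"
proof -
  show "(m / (N + 1)) ^ p \<le> (m / N) ^ p"
    using assms by (intro power_mono divide_left_mono) auto
  have "1 + real p * (- 1 / (N + 1)) \<le> (1 + (- 1 / (N + 1))) ^ p"
    using assms by (intro Bernoulli_inequality) (simp add: field_simps)
  also have "1 + (- 1 / (N + 1)) = N / (N + 1)" using assms by (simp add: field_simps)
  finally have "1 - (N / (N + 1)) ^ p \<le> real p / (N + 1)" by simp
  also have "\<dots> \<le> real p / N" using assms by (intro divide_left_mono) auto
  finally have "(m / N) ^ p * (1 - (N / (N + 1)) ^ p) \<le> (m / N) ^ p * (real p / N)"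
    using assms by (intro mult_left_mono) auto
  moreover have "(m / N) ^ p * (N / (N + 1)) ^ p = (m / (N + 1)) ^ p"
    using assms by (simp flip: power_mult_distrib)
  ultimately show "(m / N) ^ p - (m / (N + 1)) ^ p \<le> real p * (m / N) ^ p / N"
    by (simp add: right_diff_distrib mult_ac)
qed

text \<open>With $m=2j+1-N$, this is the increment of the logarithm of the weight from \<open>j\<close> to $j+1$ plus
spins (see \<open>ln_cw_term_step\<close>).\<close>

definition log_step :: "real \<Rightarrow> real \<Rightarrow> real" where
  "log_step N m = 2 * m / N - ln ((1 + m / (N + 1)) / (1 - m / (N + 1)))"

text \<open>With $k=tN^{3/4}$ this equals $-t^4/12+(t^2/2-t^6/30)/\sqrt N$, the exponent of $p_1$ together
with the bracket of $p_2$.\<close>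

definition log_profile :: "real \<Rightarrow> real \<Rightarrow> real" where
  "log_profile N k = - (k ^ 4) / (12 * N ^ 3) + k ^ 2 / (2 * N ^ 2) - k ^ 6 / (30 * N ^ 5)"

text \<open>The increment over the two neighbours $m\pm1$ is a midpoint difference, hence even powers of the
profile give odd powers of \<open>m\<close>, and these match the Taylor polynomial of the increment: the
term $k^2/(2N^2)$ of the profile comes from replacing $2m/(N+1)$ by $2m/N$, the other two from
the cubic and the quintic term.  The right-hand side collects what is left.\<close>

lemma log_step_expansion:
  assumes "1 \<le> m" "m \<le> N / 2"
  shows "\<bar>log_step N m - (log_profile N (m + 1) - log_profile N (m - 1))\<bar>
     \<le> 4 * (m / N ^ 3 + m ^ 3 / N ^ 4 + m ^ 5 / N ^ 6 + m ^ 7 / N ^ 7)"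
proof -
  have N: "N \<ge> 2" using assms by simp
  define v where "v = m / (N + 1)"
  define l where "l = ln ((1 + v) / (1 - v))"
  have v: "0 \<le> v" "v \<le> 1/2" using assms N by (auto simp: v_def field_simps)
  have l: "2 * v + 2/3 * v ^ 3 + 2/5 * v ^ 5 \<le> l" "l \<le> 2 * v + 2/3 * v ^ 3 + 2/5 * v ^ 5 + v ^ 7"
    using atanh_expansion[OF v] by (simp_all add: l_def)
  have b: "v ^ 3 \<le> m ^ 3 / N ^ 3" "m ^ 3 / N ^ 3 - v ^ 3 \<le> 3 * (m ^ 3 / N ^ 4)"
      "v ^ 5 \<le> m ^ 5 / N ^ 5" "m ^ 5 / N ^ 5 - v ^ 5 \<le> 5 * (m ^ 5 / N ^ 6)" "v ^ 7 \<le> m ^ 7 / N ^ 7"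
    using power_shift_bounds[of m N 3] power_shift_bounds[of m N 5] power_shift_bounds[of m N 7] assms N
    by (simp_all add: v_def power_divide eval_nat_numeral mult_ac)
  have v7: "v ^ 7 \<ge> 0" using v by simp
  \<comment> \<open>The quadratic energy $2m/N$ cancels the linear Taylor term up to $2m/N^2$.\<close>
  have e1: "2 * m / N - 2 * v - 2 * (m / N ^ 2) = - (2 * m / (N ^ 2 * (N + 1)))"
    using N unfolding v_def by (simp add: divide_simps power2_eq_square) algebra
  have "2 * m / (N ^ 2 * (N + 1)) \<le> 2 * m / N ^ 3"
    using N assms by (intro divide_left_mono) (auto simp: eval_nat_numeral algebra_simps add_pos_pos)
  then have e1': "2 * m / (N ^ 2 * (N + 1)) \<le> 2 * (m / N ^ 3)" by simp
  have e1'': "2 * m / (N ^ 2 * (N + 1)) \<ge> 0" using N assms by simp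
  have pr: "log_profile N (m + 1) - log_profile N (m - 1) =
     - (2/3 * (m ^ 3 / N ^ 3)) - 2/3 * (m / N ^ 3) + 2 * (m / N ^ 2)
     - (2/5 * (m ^ 5 / N ^ 5) + 4/3 * (m ^ 3 / N ^ 5) + 2/5 * (m / N ^ 5))"
  proof -
    have "log_profile N (m + 1) - log_profile N (m - 1) =
     - (((m + 1) ^ 4 - (m - 1) ^ 4) / (12 * N ^ 3)) + ((m + 1) ^ 2 - (m - 1) ^ 2) / (2 * N ^ 2)
       - ((m + 1) ^ 6 - (m - 1) ^ 6) / (30 * N ^ 5)"
      by (simp add: log_profile_def diff_divide_distrib)
    also have "(m + 1) ^ 4 - (m - 1) ^ 4 = 8 * m ^ 3 + 8 * m" by algebra
    also have "(m + 1) ^ 2 - (m - 1) ^ 2 = 4 * m" by algebra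
    also have "(m + 1) ^ 6 - (m - 1) ^ 6 = 12 * m ^ 5 + 40 * m ^ 3 + 12 * m" by algebra
    finally show ?thesis by (simp add: add_divide_distrib)
  qed
  have n1: "m ^ 3 / N ^ 5 \<le> m ^ 3 / N ^ 4" "m / N ^ 5 \<le> m / N ^ 3"
    using N assms by (auto intro!: divide_left_mono power_increasing)
  have n2: "m ^ 3 / N ^ 5 \<ge> 0" "m / N ^ 5 \<ge> 0" "m / N ^ 3 \<ge> 0" "m ^ 5 / N ^ 6 \<ge> 0" "m ^ 3 / N ^ 4 \<ge> 0"
    using N assms by auto
  have n3: "m ^ 7 / N ^ 7 \<ge> 0" using N assms by auto
  have ls: "log_step N m = 2 * m / N - l" by (simp add: log_step_def l_def v_def)
  have combine: "\<bar>(x - l) - (- (2/3 * A3) - 2/3 * a + 2 * b - (2/5 * A5 + 4/3 * c + 2/5 * d))\<bar>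
      \<le> 4 * (a + a4 + a6 + a7)"
    if "x - 2 * v - 2 * b = - z" "z \<le> 2 * a" "z \<ge> 0" "a \<ge> 0" "a4 \<ge> 0" "a6 \<ge> 0" "a7 \<ge> 0"
      "c \<le> a4" "d \<le> a" "c \<ge> 0" "d \<ge> 0" "2 * v + 2/3 * v3 + 2/5 * v5 \<le> l"
      "l \<le> 2 * v + 2/3 * v3 + 2/5 * v5 + v7" "v3 \<le> A3" "A3 - v3 \<le> 3 * a4"
      "v5 \<le> A5" "A5 - v5 \<le> 5 * a6" "v7 \<le> a7" "v7 \<ge> 0"
    for x l A3 a b A5 c d a4 a6 a7 z v v3 v5 v7 :: real
    using that by (intro abs_leI) argo+
  show ?thesis unfolding pr ls
    by (rule combine[OF e1 e1' e1'' n2(3,5,4) n3 n1 n2(1,2) l b v7])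
qed

text \<open>A one-sided bound for every $m\le N$, also where the expansion breaks down: the terms of
the artanh series are positive, so truncating it after the cubic term is harmless.  The error
$5/N$ per step adds up to a constant over the whole range.\<close>

lemma log_step_upper:
  assumes "0 \<le> m" "m \<le> N" "1 \<le> N"
  shows "log_step N m \<le> - ((m + 1) ^ 4) / (12 * N ^ 3) - (- ((m - 1) ^ 4) / (12 * N ^ 3)) + 5 / N"
proof -
  define v where "v = m / (N + 1)"
  have v: "0 \<le> v" "v < 1" using assms by (auto simp: v_def field_simps)
  have l: "2 * v + 2/3 * v ^ 3 \<le> ln ((1 + v) / (1 - v))"
    using atanh_lower[OF v] .
  have b: "(m / N) ^ 3 - v ^ 3 \<le> 3 * (m / N) ^ 3 / N"
    using power_shift_bounds(2)[of m N 3] assms by (simp add: v_def)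
  have mN: "m / N \<le> 1" "0 \<le> m / N" using assms by auto
  have "(m / N) ^ 3 \<le> 1" using mN by (intro power_le_one)
  then have "3 * (m / N) ^ 3 / N \<le> 3 / N" using assms by (intro divide_right_mono) auto
  with b have b': "(m / N) ^ 3 - v ^ 3 \<le> 3 / N" by simp
  have "2 * m / N - 2 * v = 2 * (m / (N + 1)) / N"
    using assms unfolding v_def by (simp add: divide_simps) (simp add: algebra_simps)
  also have "\<dots> \<le> 2 * 1 / N"
    using assms by (intro divide_right_mono mult_left_mono) auto
  finally have e1: "2 * m / N - 2 * v \<le> 2 / N" by simp
  have "m / N ^ 3 = (m / N) / N ^ 2" by (simp add: eval_nat_numeral)
  also have "\<dots> \<le> 1 / N"
    using assms mN by (intro frac_le) (auto simp: power2_eq_square)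
  finally have e2: "m / N ^ 3 \<le> 1 / N" .
  have "- ((m + 1) ^ 4) / (12 * N ^ 3) - (- ((m - 1) ^ 4) / (12 * N ^ 3))
     = - (((m + 1) ^ 4 - (m - 1) ^ 4) / (12 * N ^ 3))" by (simp add: diff_divide_distrib)
  also have "(m + 1) ^ 4 - (m - 1) ^ 4 = 8 * m ^ 3 + 8 * m" by algebra
  also have "- ((8 * m ^ 3 + 8 * m) / (12 * N ^ 3)) = - (2/3 * (m / N) ^ 3) - 2/3 * (m / N ^ 3)"
    by (simp add: add_divide_distrib power_divide)
  finally have pr: "- ((m + 1) ^ 4) / (12 * N ^ 3) - (- ((m - 1) ^ 4) / (12 * N ^ 3))
     = - (2/3 * (m / N) ^ 3) - 2/3 * (m / N ^ 3)" .
  have combine: "x - l \<le> - (2/3 * A) - 2/3 * a + 5 * i"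
    if "2 * v + 2/3 * v3 \<le> l" "A - v3 \<le> 3 * i" "x - 2 * v \<le> 2 * i" "a \<le> i" "i \<ge> 0"
    for x l A a i v v3 :: real
    using that by linarith
  have "2 * m / N - ln ((1 + v) / (1 - v)) \<le> - (2/3 * (m / N) ^ 3) - 2/3 * (m / N ^ 3) + 5 * (1 / N)"
    by (rule combine[OF l]) (use b' e1 e2 assms in auto)
  then show ?thesis
    unfolding log_step_def v_def[symmetric] pr by simp
qed

section \<open>The weights at the scale of the quartic density\<close>

text \<open>The total weight of the configurations with \<open>j\<close> plus spins, without the constant factor
$e^{-1/2}$ that comes from the diagonal of $S_n^2$.\<close>

definition cw_term :: "nat \<Rightarrow> nat \<Rightarrow> real" where
  "cw_term n j = real (n choose j) * exp ((2 * real j - real n) ^ 2 / (2 * real n))"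

text \<open>The smallest index with nonnegative magnetization $2j-n$, which there is 0 or 1.\<close>

definition mid :: "nat \<Rightarrow> nat" where
  "mid n = (n + 1) div 2"

lemma cw_term_pos: "j \<le> n \<Longrightarrow> cw_term n j > 0"
  by (simp add: cw_term_def)

lemma mid_le: "n \<ge> 1 \<Longrightarrow> mid n \<le> n"
  by (simp add: mid_def)

lemma mid_bounds: "0 \<le> 2 * real (mid n) - real n" "2 * real (mid n) - real n \<le> 1"
proof -
  have "n \<le> 2 * mid n" "2 * mid n \<le> n + 1" by (auto simp: mid_def)
  then have "real n \<le> real (2 * mid n)" "real (2 * mid n) \<le> real (n + 1)" unfolding of_nat_le_iff .
  then show "0 \<le> 2 * real (mid n) - real n" "2 * real (mid n) - real n \<le> 1" by simp_all
qed

lemma ln_cw_term_step: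
  assumes "j < n"
  shows "ln (cw_term n (Suc j)) - ln (cw_term n j) = log_step (real n) (2 * real j + 1 - real n)"
proof -
  define N where "N = real n"
  define m where "m = 2 * real j + 1 - N"
  have N: "N \<ge> 1" "real j \<le> N - 1" using assms by (auto simp: N_def)
  have "Suc j * (n choose Suc j) = (n - j) * (n choose j)"
    by (simp only: binomial_absorption binomial_absorb_comp diff_Suc_1)
  then have "real (Suc j * (n choose Suc j)) = real ((n - j) * (n choose j))" by simp
  then have "(real j + 1) * real (n choose Suc j) = (N - real j) * real (n choose j)"
    using assms by (simp add: N_def of_nat_diff algebra_simps)
  moreover have pos: "0 < real (n choose Suc j)" "0 < real (n choose j)" using assms by auto
  ultimately have "(real j + 1) / (N - real j) = real (n choose j) / real (n choose Suc j)"
    using N by (simp add: field_simps)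
  moreover have "(1 + m / (N + 1)) / (1 - m / (N + 1)) = (real j + 1) / (N - real j)"
  proof -
    have "1 + m / (N + 1) = 2 * (real j + 1) / (N + 1)" "1 - m / (N + 1) = 2 * (N - real j) / (N + 1)"
      using N by (simp_all add: m_def field_simps)
    moreover have "N + 1 \<noteq> 0" "N - real j \<noteq> 0" using N by auto
    ultimately show ?thesis by (simp only:) (simp add: divide_simps, simp add: algebra_simps)
  qed
  ultimately have "ln ((1 + m / (N + 1)) / (1 - m / (N + 1))) = ln (real (n choose j)) - ln (real (n choose Suc j))"
    using pos by (simp add: ln_div)
  moreover have "(2 * real (Suc j) - N) ^ 2 / (2 * N) - (2 * real j - N) ^ 2 / (2 * N) = 2 * m / N"
  proof -
    have "(2 * real (Suc j) - N) ^ 2 / (2 * N) - (2 * real j - N) ^ 2 / (2 * N)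
       = ((m + 1) ^ 2 - (m - 1) ^ 2) / (2 * N)"
    proof -
      have "2 * real (Suc j) - N = m + 1" "2 * real j - N = m - 1" by (simp_all add: m_def)
      then show ?thesis by (simp only: diff_divide_distrib)
    qed
    also have "(m + 1) ^ 2 - (m - 1) ^ 2 = 4 * m" by algebra
    finally show ?thesis by simp
  qed
  ultimately show ?thesis
    using pos by (simp add: cw_term_def log_step_def ln_mult flip: N_def m_def)
qed

lemma telescope_le:
  fixes f :: "nat \<Rightarrow> real"
  assumes "a \<le> b" "\<And>j. a \<le> j \<Longrightarrow> j < b \<Longrightarrow> f (Suc j) - f j \<le> e"
  shows "f b - f a \<le> (real b - real a) * e"
  using assms
proof (induction b rule: dec_induct)
  case (step b)
  have "f b - f a \<le> (real b - real a) * e" using step by simp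
  moreover have "f (Suc b) - f b \<le> e" using step by simp
  ultimately show ?case by (simp add: algebra_simps)
qed simp

text \<open>The error bound of \<open>log_step_expansion\<close> increases with \<open>m\<close>, so all steps from the centre up to
\<open>J\<close> obey it with \<open>K\<close> for \<open>m\<close>, and there are at most \<open>K\<close> steps.\<close>

lemma ln_cw_term_expansion:
  assumes n: "n \<ge> 1" and J: "mid n \<le> J" "J \<le> n"
  defines "N \<equiv> real n" and "K \<equiv> 2 * real J - real n" and "k0 \<equiv> 2 * real (mid n) - real n"
  assumes K: "K \<le> N / 2"
  shows "\<bar>(ln (cw_term n J) - ln (cw_term n (mid n))) - (log_profile N K - log_profile N k0)\<bar>
    \<le> 4 * K * (K / N ^ 3 + K ^ 3 / N ^ 4 + K ^ 5 / N ^ 6 + K ^ 7 / N ^ 7)"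
proof -
  define E where "E = 4 * (K / N ^ 3 + K ^ 3 / N ^ 4 + K ^ 5 / N ^ 6 + K ^ 7 / N ^ 7)"
  define f where "f = (\<lambda>j. ln (cw_term n j) - log_profile N (2 * real j - N))"
  have N: "N \<ge> 1" using n by (simp add: N_def)
  have k0: "k0 \<ge> 0" using mid_bounds by (simp add: k0_def)
  have JK: "K = 2 * (real J - real (mid n)) + k0" by (simp add: K_def k0_def)
  have J': "0 \<le> real J - real (mid n)" using J by simp
  have K0: "K \<ge> 0" using JK J' k0 by simp
  have E0: "E \<ge> 0" unfolding E_def using K0 N by simp
  have step: "\<bar>f (Suc j) - f j\<bar> \<le> E" if j: "mid n \<le> j" "j < J" for j
  proof -
    define m where "m = 2 * real j + 1 - N"
    have m1: "1 \<le> m" using mid_bounds(1)[of n] j by (simp add: m_def N_def)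
    have mK: "m \<le> K" using j by (simp add: m_def K_def N_def)
    have "\<bar>f (Suc j) - f j\<bar> = \<bar>log_step N m - (log_profile N (m + 1) - log_profile N (m - 1))\<bar>"
      using ln_cw_term_step[of j n] j J by (simp add: f_def m_def N_def algebra_simps)
    also have "\<dots> \<le> 4 * (m / N ^ 3 + m ^ 3 / N ^ 4 + m ^ 5 / N ^ 6 + m ^ 7 / N ^ 7)"
      using m1 mK K by (intro log_step_expansion) auto
    also have "\<dots> \<le> E"
      unfolding E_def using m1 mK N
      by (intro mult_left_mono add_mono divide_right_mono power_mono) auto
    finally show ?thesis .
  qed
  have "f J - f (mid n) \<le> (real J - real (mid n)) * E"
    using step J by (intro telescope_le) (auto simp: abs_le_iff)
  moreover have "(- f J) - (- f (mid n)) \<le> (real J - real (mid n)) * E"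
  proof (rule telescope_le[where f = "\<lambda>j. - f j"])
    fix j assume "mid n \<le> j" "j < J"
    from step[OF this] show "- f (Suc j) - - f j \<le> E" by linarith
  qed (rule J)
  ultimately have "\<bar>f J - f (mid n)\<bar> \<le> (real J - real (mid n)) * E" by linarith
  also have "\<dots> \<le> K * E" using E0 J' k0 JK by (intro mult_right_mono) auto
  finally show ?thesis by (simp add: f_def E_def K_def k0_def N_def algebra_simps)
qed

lemma cw_term_upper:
  assumes n: "n \<ge> 1" and J: "mid n \<le> J" "J \<le> n"
  shows "cw_term n J / cw_term n (mid n) \<le> exp 6 * exp (- ((2 * real J - real n) ^ 4) / (12 * real n ^ 3))"
proof -
  define N where "N = real n"
  define f where "f = (\<lambda>j. ln (cw_term n j) - (- ((2 * real j - N) ^ 4) / (12 * N ^ 3)))"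
  define k0 where "k0 = 2 * real (mid n) - N"
  have N: "N \<ge> 1" using n by (simp add: N_def)
  have k0: "k0 \<ge> 0" "k0 \<le> 1" using mid_bounds by (simp_all add: k0_def N_def)
  have "f J - f (mid n) \<le> (real J - real (mid n)) * (5 / N)"
  proof (rule telescope_le[OF J(1)])
    fix j assume j: "mid n \<le> j" "j < J"
    define m where "m = 2 * real j + 1 - N"
    have m1: "1 \<le> m" using mid_bounds(1)[of n] j by (simp add: m_def N_def)
    have mN: "m \<le> N" using j J by (simp add: m_def N_def)
    have "f (Suc j) - f j = log_step N m - (- ((m + 1) ^ 4) / (12 * N ^ 3) - (- ((m - 1) ^ 4) / (12 * N ^ 3)))"
      using ln_cw_term_step[of j n] j J by (simp add: f_def m_def N_def algebra_simps)
    then show "f (Suc j) - f j \<le> 5 / N"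
      using log_step_upper[of m N] m1 mN N by simp
  qed
  also have "\<dots> \<le> N * (5 / N)"
    using J N by (intro mult_right_mono) (auto simp: N_def)
  also have "\<dots> = 5" using N by simp
  finally have "f J - f (mid n) \<le> 5" .
  moreover have "k0 ^ 4 / (12 * N ^ 3) \<le> 1"
  proof -
    have "k0 ^ 4 \<le> 1" using k0 by (intro power_le_one)
    moreover have "1 \<le> N ^ 3" using N by simp
    ultimately have "k0 ^ 4 \<le> 12 * N ^ 3" by linarith
    then show ?thesis using N by (simp add: divide_le_eq_1)
  qed
  ultimately have "ln (cw_term n J) - ln (cw_term n (mid n)) \<le> 6 + - ((2 * real J - N) ^ 4) / (12 * N ^ 3)"
    by (simp add: f_def k0_def)
  then have "exp (ln (cw_term n J) - ln (cw_term n (mid n))) \<le> exp (6 + - ((2 * real J - N) ^ 4) / (12 * N ^ 3))"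
    by simp
  moreover have "exp (ln (cw_term n J) - ln (cw_term n (mid n))) = cw_term n J / cw_term n (mid n)"
    using cw_term_pos[OF J(2)] cw_term_pos[OF mid_le[OF n]] by (simp add: exp_diff)
  ultimately show ?thesis
    by (simp only: exp_add N_def)
qed

lemma exp_second_order:
  fixes y :: real
  assumes "\<bar>y\<bar> \<le> B"
  shows "\<bar>exp y - 1 - y\<bar> \<le> exp B * y ^ 2"
proof -
  have lo: "1 + y \<le> exp y" by (rule exp_ge_add_one_self)
  have "1 - y \<le> exp (- y)" using exp_ge_add_one_self[of "- y"] by simp
  from mult_left_mono[OF this, of "exp y"] have "exp y - y * exp y \<le> 1"
    by (simp add: exp_minus field_simps)
  then have up: "exp y - 1 - y \<le> y * (exp y - 1)" by (simp add: algebra_simps)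
  have B: "1 \<le> exp B" using assms by simp
  have "y * (exp y - 1) \<le> exp B * y ^ 2"
  proof (cases "y \<ge> 0")
    case True
    have "exp y - 1 \<le> y * exp y" using \<open>exp y - y * exp y \<le> 1\<close> by simp
    also have "\<dots> \<le> y * exp B" using True assms by (intro mult_left_mono) auto
    finally have "y * (exp y - 1) \<le> y * (y * exp B)" using True by (rule mult_left_mono)
    then show ?thesis by (simp add: power2_eq_square mult_ac)
  next
    case False
    have "y * (exp y - 1) \<le> y * y" using False lo by (intro mult_left_mono_neg) linarith+
    also have "\<dots> \<le> exp B * y ^ 2" using mult_right_mono[OF B, of "y ^ 2"] by (simp add: power2_eq_square)
    finally show ?thesis .
  qed
  moreover have "0 \<le> exp B * y ^ 2" by simp
  ultimately show ?thesis using lo up by linarith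
qed

text \<open>In terms of $r=n^{1/12}$ all powers of \<open>n\<close> in the problem are integral powers:
$n^{1/3}=r^4$, $\sqrt n=r^6$, $n^{3/4}=r^9$.\<close>

definition cw_scale :: "nat \<Rightarrow> real" where
  "cw_scale n = real n powr (1 / 12)"

lemma cw_scale_powers:
  assumes "n \<ge> 1"
  shows "cw_scale n \<ge> 1" "cw_scale n ^ 12 = real n" "cw_scale n ^ 4 = real n powr (1 / 3)"
    "cw_scale n ^ 9 = real n powr (3 / 4)" "cw_scale n ^ 6 = sqrt (real n)"
proof -
  have pos: "cw_scale n > 0" using assms by (simp add: cw_scale_def)
  have p: "cw_scale n ^ k = real n powr (real k / 12)" for k
    using powr_realpow[OF pos, of k, symmetric] by (simp add: cw_scale_def powr_powr)
  show "cw_scale n \<ge> 1" using assms by (simp add: cw_scale_def ge_one_powr_ge_zero)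
  show "cw_scale n ^ 12 = real n" "cw_scale n ^ 4 = real n powr (1 / 3)" "cw_scale n ^ 9 = real n powr (3 / 4)"
    using assms by (simp_all add: p)
  show "cw_scale n ^ 6 = sqrt (real n)" by (simp add: p powr_half_sqrt)
qed

lemma power_le_one_plus_power:
  fixes t :: real
  assumes "0 \<le> t" "p \<le> q"
  shows "t ^ p \<le> 1 + t ^ q"
proof (cases "t \<le> 1")
  case True
  then have "t ^ p \<le> 1" using assms by (intro power_le_one)
  then show ?thesis using assms by (simp add: add_increasing2)
next
  case False
  then have "t ^ p \<le> t ^ q" using assms by (intro power_increasing) auto
  then show ?thesis by simp
qed

text \<open>The density $p_1+p_2/\sqrt n$, including the first-order correction.\<close>

definition phi :: "nat \<Rightarrow> real \<Rightarrow> real" where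
  "phi n t = p1 t + p2 t / cw_scale n ^ 6"

text \<open>The value of $W_n$ on configurations with \<open>j\<close> plus spins.\<close>

definition node :: "nat \<Rightarrow> nat \<Rightarrow> real" where
  "node n j = (2 * real j - real n) / cw_scale n ^ 9"

lemma node_nonneg_iff:
  assumes "n \<ge> 1"
  shows "0 \<le> node n j \<longleftrightarrow> real n \<le> 2 * real j"
proof -
  have "cw_scale n ^ 9 > 0" using cw_scale_powers(1)[OF assms] by simp
  then show ?thesis by (auto simp: node_def zero_le_divide_iff)
qed

lemma mid_le_of_node_nonneg:
  assumes "n \<ge> 1" "0 \<le> node n j"
  shows "mid n \<le> j"
  using assms(2) unfolding node_nonneg_iff[OF assms(1)] by (auto simp: mid_def)

lemma node_power:
  assumes n: "n \<ge> 1" and abc: "9 * a + c = 12 * b"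
  shows "(2 * real j - real n) ^ a / real n ^ b = node n j ^ a / cw_scale n ^ c"
proof -
  have r: "cw_scale n \<ge> 1" "cw_scale n ^ 12 = real n" using cw_scale_powers[OF n] by auto
  have "2 * real j - real n = node n j * cw_scale n ^ 9" using r(1) by (simp add: node_def)
  then have "(2 * real j - real n) ^ a = node n j ^ a * cw_scale n ^ (9 * a)"
    unfolding power_mult by (simp add: power_mult_distrib)
  moreover have "real n ^ b = cw_scale n ^ (9 * a) * cw_scale n ^ c"
    unfolding r(2)[symmetric] power_mult[symmetric] abc[symmetric] power_add ..
  ultimately show ?thesis using r(1) by simp
qed

lemma node_weight_upper:
  assumes n: "n \<ge> 1" and j: "j \<le> n" "node n j \<ge> 0"
  shows "cw_term n j / cw_term n (mid n) \<le> exp 6 * p1 (node n j)"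
proof -
  have "(2 * real j - real n) ^ 4 / (12 * real n ^ 3) = node n j ^ 4 / 12"
    using node_power[OF n, of 4 0 3 j] by simp
  then have eq: "- ((2 * real j - real n) ^ 4) / (12 * real n ^ 3) = - (node n j ^ 4) / 12"
    by (simp only: minus_divide_left[symmetric])
  show ?thesis
    unfolding p1_def eq[symmetric] using cw_term_upper[OF n mid_le_of_node_nonneg[OF n j(2)] j(1)] .
qed

text \<open>Beyond $n^{1/12}$ the correction term may dominate, since $s^6\ge\sqrt n$, but then the
permitted error $s^{12}/n$ is larger still.\<close>

lemma phi_beyond_scale:
  assumes n: "n \<ge> 1" and s: "cw_scale n \<le> s"
  shows "1 \<le> s ^ 12 / cw_scale n ^ 12"
    and "\<bar>phi n s\<bar> \<le> 2 * (s ^ 12 / cw_scale n ^ 12) * p1 s"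
proof -
  define r where "r = cw_scale n"
  have r: "r \<ge> 1" using cw_scale_powers(1)[OF n] by (simp add: r_def)
  define q where "q = s ^ 2 / 2 - s ^ 6 / 30"
  define Y where "Y = s ^ 12 / r ^ 12"
  have rs: "r \<le> s" "s \<ge> 1" using r s by (auto simp: r_def)
  have "r ^ 6 \<le> s ^ 6" using rs r by (intro power_mono) auto
  then have z: "1 \<le> s ^ 6 / r ^ 6" using r by simp
  have "s ^ 6 / r ^ 6 * 1 \<le> s ^ 6 / r ^ 6 * (s ^ 6 / r ^ 6)" using z by (intro mult_left_mono) auto
  then have zY: "s ^ 6 / r ^ 6 \<le> Y" by (simp add: Y_def flip: power_add)
  have Y1: "1 \<le> Y" using z zY by simp
  then show "1 \<le> s ^ 12 / cw_scale n ^ 12" by (simp add: Y_def r_def)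
  have "s ^ 2 \<le> s ^ 6" using rs by (intro power_increasing) auto
  moreover have "\<bar>q\<bar> \<le> s ^ 2 / 2 + s ^ 6 / 30" using rs by (simp add: q_def abs_le_iff)
  moreover have "0 \<le> s ^ 6" by simp
  ultimately have "\<bar>q\<bar> \<le> s ^ 6" by argo
  then have "\<bar>q\<bar> / r ^ 6 \<le> s ^ 6 / r ^ 6" using r by (intro divide_right_mono) auto
  then have "\<bar>q / r ^ 6\<bar> \<le> Y" using zY r by simp
  then have "\<bar>1 + q / r ^ 6\<bar> \<le> 2 * Y" using Y1 by linarith
  then have "\<bar>1 + q / r ^ 6\<bar> * p1 s \<le> 2 * Y * p1 s" by (rule mult_right_mono) simp
  moreover have "phi n s = (1 + q / r ^ 6) * p1 s"
    by (simp add: phi_def p2_def p1_def q_def r_def algebra_simps)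
  ultimately show "\<bar>phi n s\<bar> \<le> 2 * (s ^ 12 / cw_scale n ^ 12) * p1 s"
    by (simp add: abs_mult Y_def r_def)
qed

text \<open>With $X=(1+t^{12})/n$, the exponent of a weight at $t\le n^{1/12}$ differs from $-t^4/12$ by some
\<open>y\<close> with $|y|\le 36$ and $y^2\le 1160X$, and \<open>y\<close> is known up to an error of $17X$.\<close>

definition local_const :: real where
  "local_const = 17 + 1160 * exp 36"

lemma local_const_ge: "local_const \<ge> 3 + exp 6" "local_const \<ge> 0"
proof -
  have "exp 6 \<le> exp (36::real)" by simp
  moreover have "0 \<le> exp (36::real)" by simp
  ultimately show "local_const \<ge> 3 + exp 6" "local_const \<ge> 0"
    unfolding local_const_def by linarith+
qed

text \<open>For $t\le n^{1/12}$ the weight is $p_1(t)e^y$ with $y=q/\sqrt n+e$ bounded, where $q$ is the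
bracket of $p_2$ and $e$ is the error of the expansion of the logarithm; then
$e^y=1+q/\sqrt n+O(|e|+y^2)$ and $q^2/n$ is of order $(1+t^{12})/n$.  For larger \<open>t\<close> both
terms on the left are separately small enough.\<close>

lemma local_limit:
  assumes n: "n \<ge> 64" and j: "j \<le> n" "node n j \<ge> 0"
  defines "t \<equiv> node n j"
  shows "\<bar>cw_term n j / cw_term n (mid n) - phi n t\<bar>
     \<le> local_const * ((1 + t ^ 12) / cw_scale n ^ 12) * p1 t"
proof -
  define r where "r = cw_scale n"
  define N where "N = real n"
  define K where "K = 2 * real j - N"
  define k0 where "k0 = 2 * real (mid n) - N"
  define q where "q = t ^ 2 / 2 - t ^ 6 / 30"
  define w where "w = cw_term n j / cw_term n (mid n)"
  have n1: "n \<ge> 1" using n by simp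
  have r: "r \<ge> 1" "r ^ 12 = N" using cw_scale_powers[OF n1] by (auto simp: r_def N_def)
  have N: "N \<ge> 64" using n by (simp add: N_def)
  have mj: "mid n \<le> j" by (rule mid_le_of_node_nonneg[OF n1 j(2)])
  have t0: "t \<ge> 0" using j by (simp add: t_def)
  have K: "K = t * r ^ 9" using r(1) by (simp add: t_def K_def N_def node_def r_def)
  have K0: "K \<ge> 0" using r(1) t0 by (simp add: K)
  have KN_power: "K ^ a / N ^ b = t ^ a / r ^ c" if "9 * a + c = 12 * b" for a b c
    using node_power[OF n1 that] by (simp add: K_def N_def t_def r_def)
  have p2q: "p2 t = q * p1 t" by (simp add: p2_def p1_def q_def)
  have w0: "w \<ge> 0" by (simp add: w_def cw_term_def)
  have "\<bar>w - phi n t\<bar> \<le> local_const * ((1 + t ^ 12) / r ^ 12) * p1 t"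
  proof (cases "t \<le> r")
    case True
    define e where "e = ln (cw_term n j) - ln (cw_term n (mid n)) - log_profile N K"
    define X where "X = (1 + t ^ 12) / r ^ 12"
    have "t ^ 12 \<le> r ^ 12" using True t0 by (intro power_mono)
    moreover have "1 \<le> r ^ 12" using r(1) by (rule one_le_power)
    ultimately have "1 + t ^ 12 \<le> 2 * r ^ 12" by linarith
    then have X2: "X \<le> 2" using r(1) unfolding X_def by (simp add: divide_le_eq)
    \<comment> \<open>The bound $n\ge64$ is exactly what gives $r^2\ge2$ and keeps the artanh argument below $1/2$.\<close>
    have KN: "K \<le> N / 2"
    proof -
      have r2: "r ^ 2 \<ge> 2"
      proof (rule ccontr)
        assume "\<not> 2 \<le> r ^ 2"
        then have "(r ^ 2) ^ 6 < 2 ^ 6" using r by (intro power_strict_mono) auto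
        then show False using r N by (simp flip: power_mult)
      qed
      have "K \<le> r * r ^ 9" using True r K by (simp add: mult_right_mono)
      also have "\<dots> = r ^ 10" by (simp add: eval_nat_numeral)
      finally have "K * 2 \<le> r ^ 10 * r ^ 2" using r2 K0 r by (intro mult_mono) auto
      then show ?thesis using r(2) by (simp flip: power_add)
    qed
    have e_bound: "\<bar>e\<bar> \<le> 17 * X"
    proof -
      have b: "\<bar>e + log_profile N k0\<bar> \<le> 4 * K * (K / N ^ 3 + K ^ 3 / N ^ 4 + K ^ 5 / N ^ 6 + K ^ 7 / N ^ 7)"
        using ln_cw_term_expansion[OF _ mj j(1)] KN n by (simp add: e_def K_def N_def k0_def algebra_simps)
      have s: "K * (K / N ^ 3) = t ^ 2 / r ^ 18" "K * (K ^ 3 / N ^ 4) = t ^ 4 / r ^ 12"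
        "K * (K ^ 5 / N ^ 6) = t ^ 6 / r ^ 18" "K * (K ^ 7 / N ^ 7) = t ^ 8 / r ^ 12"
        using KN_power[of 2 18 3] KN_power[of 4 12 4] KN_power[of 6 18 6] KN_power[of 8 12 7]
        by (simp_all flip: power_Suc power2_eq_square)
      have u: "t ^ p / r ^ k \<le> X" if "p \<le> 12" "k \<ge> 12" for p k
      proof -
        have "t ^ p / r ^ k \<le> (1 + t ^ 12) / r ^ 12"
          using power_le_one_plus_power[OF t0 that(1)] t0 r that
          by (intro frac_le) (auto intro: power_increasing)
        then show ?thesis by (simp add: X_def)
      qed
      have "4 * K * (K / N ^ 3 + K ^ 3 / N ^ 4 + K ^ 5 / N ^ 6 + K ^ 7 / N ^ 7)
         = 4 * (t ^ 2 / r ^ 18 + t ^ 4 / r ^ 12 + t ^ 6 / r ^ 18 + t ^ 8 / r ^ 12)"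
        unfolding s[symmetric] by (simp add: algebra_simps)
      also have "\<dots> \<le> 4 * (X + X + X + X)"
        by (intro mult_left_mono add_mono u) auto
      finally have b1: "4 * K * (K / N ^ 3 + K ^ 3 / N ^ 4 + K ^ 5 / N ^ 6 + K ^ 7 / N ^ 7) \<le> 16 * X"
        by simp
      have k0: "k0 \<ge> 0" "k0 \<le> 1" using mid_bounds by (simp_all add: k0_def N_def)
      have kk: "k0 ^ a / (c * N ^ b) \<le> 1 / (c * N)" "k0 ^ a / (c * N ^ b) \<ge> 0" if "b \<ge> 1" "c > 0" for a b c
      proof -
        have "N ^ 1 \<le> N ^ b" using N that by (intro power_increasing) auto
        then show "k0 ^ a / (c * N ^ b) \<le> 1 / (c * N)"
          using k0 N that by (intro frac_le mult_left_mono power_le_one) auto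
        show "k0 ^ a / (c * N ^ b) \<ge> 0" using k0 N that by simp
      qed
      have k2: "\<bar>log_profile N k0\<bar> \<le> 1 / (12 * N) + 1 / (2 * N) + 1 / (30 * N)"
        using kk[of 3 12 4] kk[of 2 2 2] kk[of 5 30 6] unfolding log_profile_def minus_divide_left
        by linarith
      have "1 / (12 * N) + 1 / (2 * N) + 1 / (30 * N) \<le> 1 / N" using N by (simp add: field_simps)
      also have "\<dots> \<le> X" unfolding X_def r(2) using N t0 by (intro divide_right_mono) auto
      finally show ?thesis using b b1 k2 by linarith
    qed
    have profile: "log_profile N K = - (t ^ 4) / 12 + q / r ^ 6"
    proof -
      have "K ^ 4 / (12 * N ^ 3) = t ^ 4 / 12" "K ^ 2 / (2 * N ^ 2) = t ^ 2 / 2 / r ^ 6"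
        "K ^ 6 / (30 * N ^ 5) = t ^ 6 / 30 / r ^ 6"
        using KN_power[of 4 0 3] KN_power[of 2 6 2] KN_power[of 6 6 5] by simp_all
      then show ?thesis by (simp add: log_profile_def q_def diff_divide_distrib)
    qed
    define y where "y = q / r ^ 6 + e"
    have "w = exp (ln (cw_term n j) - ln (cw_term n (mid n)))"
      using cw_term_pos[OF j(1)] cw_term_pos[OF mid_le[of n]] n by (simp add: w_def exp_diff)
    also have "ln (cw_term n j) - ln (cw_term n (mid n)) = - (t ^ 4) / 12 + y"
      using profile by (simp add: e_def y_def)
    finally have w_eq: "w = p1 t * exp y" unfolding p1_def by (simp only: exp_add)
    have q_bound: "\<bar>q\<bar> \<le> 1 + t ^ 6"
    proof -
      have "\<bar>q\<bar> \<le> t ^ 2 / 2 + t ^ 6 / 30" using t0 by (simp add: q_def abs_le_iff)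
      moreover have "t ^ 2 \<le> 1 + t ^ 6" using t0 by (intro power_le_one_plus_power) auto
      moreover have "0 \<le> t ^ 6" using t0 by simp
      ultimately show ?thesis by argo
    qed
    have q2: "\<bar>q / r ^ 6\<bar> \<le> 2"
    proof -
      have "t ^ 6 \<le> r ^ 6" using True t0 by (intro power_mono)
      moreover have "1 \<le> r ^ 6" using r by simp
      ultimately have "\<bar>q\<bar> \<le> 2 * r ^ 6" using q_bound by linarith
      then show ?thesis using r by (simp add: field_simps)
    qed
    have qX: "(q / r ^ 6) ^ 2 \<le> 2 * X"
    proof -
      have "q ^ 2 \<le> (1 + t ^ 6) ^ 2" using q_bound by (simp add: abs_le_square_iff[symmetric])
      also have "\<dots> = 1 + t ^ 12 + 2 * t ^ 6" by (simp add: power2_eq_square algebra_simps flip: power_add)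
      also have "2 * t ^ 6 \<le> 1 + t ^ 12"
        using sum_squares_ge_zero[of "1 - t ^ 6" 0] by (simp add: algebra_simps flip: power_add)
      finally have "q ^ 2 \<le> 2 * (1 + t ^ 12)" by simp
      then have "q ^ 2 / r ^ 12 \<le> 2 * (1 + t ^ 12) / r ^ 12" using r by (intro divide_right_mono) auto
      then show ?thesis by (simp add: X_def power_divide flip: power_mult)
    qed
    have yB: "\<bar>y\<bar> \<le> 36" using q2 e_bound X2 unfolding y_def by linarith
    have e2: "e ^ 2 \<le> 34 * (17 * X)"
    proof -
      have "e ^ 2 = \<bar>e\<bar> * \<bar>e\<bar>" by (simp add: power2_eq_square)
      also have "\<dots> \<le> 34 * (17 * X)" using e_bound X2 by (intro mult_mono) auto
      finally show ?thesis .
    qed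
    have "y ^ 2 \<le> 2 * (q / r ^ 6) ^ 2 + 2 * e ^ 2"
    proof -
      have "(a + b) ^ 2 \<le> 2 * a ^ 2 + 2 * b ^ 2" for a b :: real
        using zero_le_power2[of "a - b"] unfolding power2_eq_square by (simp add: algebra_simps)
      then show ?thesis unfolding y_def .
    qed
    also have "\<dots> \<le> 2 * (2 * X) + 2 * (34 * (17 * X))" by (intro add_mono mult_left_mono qX e2) auto
    finally have y2: "y ^ 2 \<le> 1160 * X" by simp
    have "exp 36 * y ^ 2 \<le> exp 36 * (1160 * X)" using y2 by simp
    with exp_second_order[OF yB] have "\<bar>exp y - 1 - y\<bar> \<le> exp 36 * (1160 * X)" by linarith
    then have "\<bar>exp y - 1 - q / r ^ 6\<bar> \<le> exp 36 * (1160 * X) + 17 * X"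
      using e_bound unfolding y_def by linarith
    also have "\<dots> = local_const * X" by (simp add: local_const_def algebra_simps)
    finally have "p1 t * \<bar>exp y - 1 - q / r ^ 6\<bar> \<le> p1 t * (local_const * X)"
      by (rule mult_left_mono) simp
    moreover have "\<bar>w - phi n t\<bar> = p1 t * \<bar>exp y - 1 - q / r ^ 6\<bar>"
    proof -
      have "w - phi n t = p1 t * (exp y - 1 - q / r ^ 6)"
        unfolding w_eq phi_def p2q r_def by (simp add: algebra_simps)
      then show ?thesis by (simp add: abs_mult)
    qed
    ultimately show ?thesis by (simp add: X_def mult_ac)
  next
    case False
    then have tr: "r < t" by simp
    define Y where "Y = t ^ 12 / r ^ 12"
    have Y: "1 \<le> Y" "\<bar>phi n t\<bar> \<le> 2 * Y * p1 t"
      using phi_beyond_scale[OF n1, of t] tr by (simp_all add: r_def Y_def)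
    have "w \<le> exp 6 * p1 t"
      using node_weight_upper[OF n1 j] by (simp add: w_def t_def)
    also have "\<dots> \<le> exp 6 * Y * p1 t" using Y(1) by simp
    finally have "\<bar>w - phi n t\<bar> \<le> exp 6 * Y * p1 t + 2 * Y * p1 t"
      using w0 Y(2) by linarith
    also have "\<dots> = (2 + exp 6) * Y * p1 t" by (simp add: algebra_simps)
    also have "\<dots> \<le> local_const * ((1 + t ^ 12) / r ^ 12) * p1 t"
      unfolding Y_def using local_const_ge r(1) t0
      by (intro mult_mono mult_right_mono divide_right_mono) auto
    finally show ?thesis .
  qed
  then show ?thesis by (simp add: w_def r_def)
qed

section \<open>From sums over nodes to integrals\<close>

text \<open>The relative error of the theorem, $(s^{12}+n^{1/3})/n$.\<close>

definition err :: "nat \<Rightarrow> real \<Rightarrow> real" where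
  "err n s = (s ^ 12 + cw_scale n ^ 4) / cw_scale n ^ 12"

text \<open>The spacing of the values of $W_n$.\<close>

definition mesh :: "nat \<Rightarrow> real" where
  "mesh n = 2 / cw_scale n ^ 9"

text \<open>Shifting the argument of the error by at most 2, a bound for the mesh width, only changes it by
a constant factor ($531442=3^{12}+1$).\<close>

lemma power12_shift_le:
  assumes "n \<ge> 1" "s \<ge> 0"
  shows "(1 + (s + 2) ^ 12) / cw_scale n ^ 12 \<le> 531442 * err n s"
    and "((s + 2) ^ 12 + cw_scale n ^ 4) / cw_scale n ^ 12 \<le> 531442 * err n s"
proof -
  have r: "cw_scale n \<ge> 1" using cw_scale_powers(1)[OF assms(1)] .
  then have r4: "1 \<le> cw_scale n ^ 4" by (intro one_le_power)
  have "(s + 2) ^ 12 \<le> 3 ^ 12 * (s ^ 12 + 1)"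
  proof (cases "s \<le> 1")
    case True
    then have "(s + 2) ^ 12 \<le> 3 ^ 12" using assms by (intro power_mono) auto
    also have "(3::real) ^ 12 * 1 \<le> 3 ^ 12 * (s ^ 12 + 1)" using assms by (intro mult_left_mono) auto
    finally show ?thesis by simp
  next
    case False
    then have "(s + 2) ^ 12 \<le> (3 * s) ^ 12" by (intro power_mono) auto
    then show ?thesis by (simp add: power_mult_distrib)
  qed
  then have "(s + 2) ^ 12 \<le> 531441 * s ^ 12 + 531441" by simp
  moreover have "0 \<le> s ^ 12" using assms by simp
  ultimately have "1 + (s + 2) ^ 12 \<le> 531442 * (s ^ 12 + cw_scale n ^ 4)"
    "(s + 2) ^ 12 + cw_scale n ^ 4 \<le> 531442 * (s ^ 12 + cw_scale n ^ 4)"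
    using r4 unfolding distrib_left by linarith+
  then show "(1 + (s + 2) ^ 12) / cw_scale n ^ 12 \<le> 531442 * err n s"
    "((s + 2) ^ 12 + cw_scale n ^ 4) / cw_scale n ^ 12 \<le> 531442 * err n s"
    unfolding err_def using r by (simp_all add: divide_right_mono)
qed

text \<open>A form of Young's inequality, after multiplication by $r^{12}$: $u^3r^3$ is at most $u^{12}$ when $r\le u^3$, and at most $r^4$
otherwise.\<close>

lemma cube_mesh_le:
  assumes "n \<ge> 1" "u \<ge> 0"
  shows "u ^ 3 / cw_scale n ^ 9 \<le> (u ^ 12 + cw_scale n ^ 4) / cw_scale n ^ 12"
proof -
  define r where "r = cw_scale n"
  have r: "r \<ge> 1" using cw_scale_powers(1)[OF assms(1)] by (simp add: r_def)
  have "u ^ 3 * r ^ 3 \<le> u ^ 12 + r ^ 4"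
  proof (cases "r \<le> u ^ 3")
    case True
    then have "r ^ 3 \<le> (u ^ 3) ^ 3" using r by (intro power_mono) auto
    then have "u ^ 3 * r ^ 3 \<le> u ^ 3 * (u ^ 3) ^ 3" using assms by (intro mult_left_mono) auto
    also have "\<dots> = u ^ 12" by (simp flip: power_mult power_add)
    finally show ?thesis using r by (simp add: add_increasing2)
  next
    case False
    then have "u ^ 3 * r ^ 3 \<le> r * r ^ 3" using r by (intro mult_right_mono) auto
    also have "\<dots> = r ^ 4" by (simp add: eval_nat_numeral)
    finally show ?thesis using assms by (simp add: add_increasing)
  qed
  then have "u ^ 3 * r ^ 3 / r ^ 12 \<le> (u ^ 12 + r ^ 4) / r ^ 12"
    using r by (intro divide_right_mono) auto
  moreover have "u ^ 3 * r ^ 3 / r ^ 12 = u ^ 3 / r ^ 9"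
    using r by (simp add: field_simps flip: power_add)
  ultimately show ?thesis by (simp add: r_def)
qed

lemma phi_deriv:
  "DERIV (phi n) x :> p1 x * (- (x ^ 3) / 3 + (x - x ^ 5 / 5 - x ^ 3 / 3 * (x ^ 2 / 2 - x ^ 6 / 30)) / cw_scale n ^ 6)"
proof -
  have d1: "DERIV p1 x :> - (x ^ 3) / 3 * p1 x"
    unfolding p1_def[abs_def] by (auto intro!: derivative_eq_intros)
  have d2: "DERIV p2 x :> (x - x ^ 5 / 5) * p1 x + (x ^ 2 / 2 - x ^ 6 / 30) * (- (x ^ 3) / 3 * p1 x)"
  proof -
    have p2: "p2 = (\<lambda>t. (t ^ 2 / 2 - t ^ 6 / 30) * p1 t)" by (auto simp: p2_def p1_def)
    have "DERIV (\<lambda>t. t ^ 2 / 2 - t ^ 6 / 30) x :> x - x ^ 5 / 5"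
      by (auto intro!: derivative_eq_intros)
    from DERIV_mult[OF this d1] show ?thesis
      unfolding p2 by (simp only: mult.commute[of "- (x ^ 3) / 3 * p1 x"])
  qed
  have "DERIV (phi n) x :> - (x ^ 3) / 3 * p1 x
    + ((x - x ^ 5 / 5) * p1 x + (x ^ 2 / 2 - x ^ 6 / 30) * (- (x ^ 3) / 3 * p1 x)) / cw_scale n ^ 6"
    unfolding phi_def[abs_def] by (intro DERIV_add DERIV_cdivide d1 d2)
  also have "- (x ^ 3) / 3 * p1 x
    + ((x - x ^ 5 / 5) * p1 x + (x ^ 2 / 2 - x ^ 6 / 30) * (- (x ^ 3) / 3 * p1 x)) / cw_scale n ^ 6
    = p1 x * (- (x ^ 3) / 3 + (x - x ^ 5 / 5 - x ^ 3 / 3 * (x ^ 2 / 2 - x ^ 6 / 30)) / cw_scale n ^ 6)"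
  proof -
    have "- c * p + (a * p + q * (- c * p)) / R = p * (- c + (a - c * q) / R)" for a c p q R :: real
    proof -
      have "a * p + q * (- c * p) = p * (a - c * q)" by (simp add: right_diff_distrib mult_ac)
      then show ?thesis by (simp only: distrib_left times_divide_eq_right) (simp add: mult_ac)
    qed
    from this[of "x ^ 3 / 3"] show ?thesis by simp
  qed
  finally show ?thesis .
qed

lemma mesh_bounds: "n \<ge> 1 \<Longrightarrow> 0 < mesh n \<and> mesh n \<le> 2"
proof -
  assume "n \<ge> 1"
  then have "1 \<le> cw_scale n" by (rule cw_scale_powers)
  then have "1 \<le> cw_scale n ^ 9" by (rule one_le_power)
  moreover have "0 < 2 / c \<and> 2 / c \<le> 2" if "1 \<le> c" for c :: real
    using that by (simp add: divide_le_eq)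
  ultimately show ?thesis unfolding mesh_def by blast
qed

text \<open>By the mean value theorem; the derivative of \<open>phi\<close> is $p_1$ times a polynomial whose
leading terms $s^3$ and $s^9/\sqrt n$ become part of the error once multiplied by the mesh.
Comparing at the left end of the interval is essential, since $p_1$ decreases and so its value
there dominates.\<close>

lemma phi_variation:
  assumes n: "n \<ge> 1" and s: "0 \<le> s" "s < t" "t \<le> s + mesh n"
  shows "\<bar>phi n t - phi n s\<bar> \<le> 10 * 531442 * err n s * p1 s"
proof -
  define r where "r = cw_scale n"
  have r: "r \<ge> 1" using cw_scale_powers(1)[OF n] by (simp add: r_def)
  define u where "u = s + 2"
  obtain z where z: "s < z" "z < t" "phi n t - phi n s = (t - s) *
     (p1 z * (- (z ^ 3) / 3 + (z - z ^ 5 / 5 - z ^ 3 / 3 * (z ^ 2 / 2 - z ^ 6 / 30)) / r ^ 6))"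
    using MVT2[OF s(2) phi_deriv, of n] unfolding r_def by auto
  have zu: "0 \<le> z" "z \<le> u" "u \<ge> 1" using z s mesh_bounds[OF n] by (auto simp: u_def)
  have zp: "z ^ p \<le> u ^ q" if "p \<le> q" for p q
  proof -
    have "z ^ p \<le> u ^ p" using zu by (intro power_mono)
    also have "\<dots> \<le> u ^ q" using zu that by (intro power_increasing)
    finally show ?thesis .
  qed
  have zp0: "0 \<le> z ^ p" for p using zu by simp
  have "\<bar>z - z ^ 5 / 5 - z ^ 3 / 3 * (z ^ 2 / 2 - z ^ 6 / 30)\<bar> \<le> 4 * u ^ 9"
  proof -
    have eq: "z - z ^ 5 / 5 - z ^ 3 / 3 * (z ^ 2 / 2 - z ^ 6 / 30) = z ^ 1 - z ^ 5 / 5 - z ^ 5 / 6 + z ^ 9 / 90"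
      by (simp add: algebra_simps flip: power_add)
    have "z ^ 1 \<le> u ^ 9" "z ^ 5 \<le> u ^ 9" "z ^ 9 \<le> u ^ 9" by (rule zp, simp)+
    then show ?thesis
      unfolding eq using zp0[of 1] zp0[of 5] zp0[of 9] by (intro abs_leI) argo+
  qed
  then have "\<bar>(z - z ^ 5 / 5 - z ^ 3 / 3 * (z ^ 2 / 2 - z ^ 6 / 30)) / r ^ 6\<bar> \<le> 4 * u ^ 9 / r ^ 6"
    using r by (simp add: divide_right_mono)
  moreover have "\<bar>- (z ^ 3) / 3\<bar> \<le> u ^ 3" using zp[OF order_refl, of 3] zp0[of 3] by (intro abs_leI) argo+
  ultimately have D: "\<bar>- (z ^ 3) / 3 + (z - z ^ 5 / 5 - z ^ 3 / 3 * (z ^ 2 / 2 - z ^ 6 / 30)) / r ^ 6\<bar>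
     \<le> u ^ 3 + 4 * u ^ 9 / r ^ 6" by linarith
  have "\<bar>phi n t - phi n s\<bar> = (t - s) * (p1 z *
     \<bar>- (z ^ 3) / 3 + (z - z ^ 5 / 5 - z ^ 3 / 3 * (z ^ 2 / 2 - z ^ 6 / 30)) / r ^ 6\<bar>)"
    unfolding z(3) using s by (simp add: abs_mult)
  also have "\<dots> \<le> (2 / r ^ 9) * (p1 s * (u ^ 3 + 4 * u ^ 9 / r ^ 6))"
    using s z D p1_antimono[of s z] r zu
    by (intro mult_mono) (auto simp: mesh_def r_def intro!: mult_nonneg_nonneg add_nonneg_nonneg)
  also have "\<dots> = (2 * (u ^ 3 / r ^ 9) + 8 * (u ^ 9 / r ^ 15)) * p1 s"
    using r by (simp add: field_simps flip: power_add)
  also have "\<dots> \<le> (2 * ((u ^ 12 + r ^ 4) / r ^ 12) + 8 * ((u ^ 12 + r ^ 4) / r ^ 12)) * p1 s"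
  proof (intro mult_right_mono add_mono mult_left_mono)
    show "u ^ 3 / r ^ 9 \<le> (u ^ 12 + r ^ 4) / r ^ 12"
      using cube_mesh_le[OF n, of u] zu by (simp add: r_def)
    have "u ^ 9 \<le> u ^ 12" using zu by (intro power_increasing) auto
    also have "\<dots> \<le> u ^ 12 + r ^ 4" using r by simp
    finally show "u ^ 9 / r ^ 15 \<le> (u ^ 12 + r ^ 4) / r ^ 12"
      using r zu by (intro frac_le) (auto intro: power_increasing)
  qed auto
  also have "\<dots> = 10 * (((s + 2) ^ 12 + cw_scale n ^ 4) / cw_scale n ^ 12) * p1 s"
  proof -
    have "(2 * a + 8 * a) * p = 10 * a * p" for a p :: real by simp
    then show ?thesis unfolding u_def r_def .
  qed
  also have "\<dots> \<le> 10 * (531442 * err n s) * p1 s"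
    by (intro mult_right_mono mult_left_mono power12_shift_le(2)[OF n s(1)]) auto
  finally show ?thesis by simp
qed

lemma err_nonneg: "n \<ge> 1 \<Longrightarrow> s \<ge> 0 \<Longrightarrow> err n s \<ge> 0"
  using cw_scale_powers(1)[of n] by (simp add: err_def)

text \<open>The rectangle over a node extends to its left, so that its height is compared with \<open>phi\<close> at
smaller arguments, where $p_1$ is larger.\<close>

definition step_fun :: "nat \<Rightarrow> real \<Rightarrow> real \<Rightarrow> real" where
  "step_fun n x s = (\<Sum>j | j \<le> n \<and> x < node n j.
     cw_term n j / cw_term n (mid n) * indicator {node n j - mesh n..<node n j} s)"

lemma cell_iff:
  assumes "n \<ge> 1"
  shows "s \<in> {node n j - mesh n..<node n j} \<longleftrightarrow>
    2 * real j - 2 \<le> s * cw_scale n ^ 9 + real n \<and> s * cw_scale n ^ 9 + real n < 2 * real j"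
proof -
  have r: "cw_scale n ^ 9 > 0" using cw_scale_powers(1)[OF assms] by simp
  have "node n j - mesh n = (2 * real j - 2 - real n) / cw_scale n ^ 9"
    by (simp add: node_def mesh_def diff_divide_distrib)
  then show ?thesis
    using r by (auto simp: node_def pos_divide_le_eq pos_less_divide_eq)
qed

lemma step_fun_eq:
  assumes n: "n \<ge> 1" and j: "j \<le> n" "x < node n j" "s \<in> {node n j - mesh n..<node n j}"
  shows "step_fun n x s = cw_term n j / cw_term n (mid n)"
proof -
  have "step_fun n x s = (\<Sum>i\<in>{j}. cw_term n i / cw_term n (mid n) * indicator {node n i - mesh n..<node n i} s)"
    unfolding step_fun_def
  proof (rule sum.mono_neutral_right)
    show "\<forall>i\<in>{j. j \<le> n \<and> x < node n j} - {j}.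
        cw_term n i / cw_term n (mid n) * indicator {node n i - mesh n..<node n i} s = 0"
    proof
      fix i assume i: "i \<in> {j. j \<le> n \<and> x < node n j} - {j}"
      have "s \<notin> {node n i - mesh n..<node n i}"
      proof
        assume "s \<in> {node n i - mesh n..<node n i}"
        then have "2 * real i - 2 < 2 * real j" "2 * real j - 2 < 2 * real i"
          using j(3) unfolding cell_iff[OF n] by linarith+
        then have "i = j" by linarith
        then show False using i by simp
      qed
      then show "cw_term n i / cw_term n (mid n) * indicator {node n i - mesh n..<node n i} s = 0"
        by simp
    qed
  qed (use j in auto)
  then show ?thesis using j(3) by simp
qed

lemma step_fun_eq_0:
  assumes "\<And>j. j \<le> n \<Longrightarrow> x < node n j \<Longrightarrow> s \<notin> {node n j - mesh n..<node n j}"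
  shows "step_fun n x s = 0"
  unfolding step_fun_def by (rule sum.neutral) (use assms in auto)

definition step_const :: real where
  "step_const = 531442 * local_const + 10 * 531442 + 2"

text \<open>To the right of \<open>x\<close> the step function takes the weight of the next node, or 0 beyond
the last node $n^{1/4}$.  To the left of \<open>x\<close> only the one rectangle straddling \<open>x\<close> contributes;
this is the last term.\<close>

lemma step_fun_approx:
  assumes n: "n \<ge> 64" and x: "x \<ge> 0"
  shows "\<bar>step_fun n x s - indicator {x..} s * phi n s\<bar>
    \<le> indicator {x..} s * (step_const * err n s * p1 s) + exp 6 * p1 x * indicator {x - mesh n..x} s"
proof (cases "s \<ge> x")
  case True
  have n1: "n \<ge> 1" using n by simp
  have s0: "s \<ge> 0" using True x by simp
  define r where "r = cw_scale n"
  have r: "r \<ge> 1" "r ^ 12 = real n" using cw_scale_powers[OF n1] by (simp_all add: r_def)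
  have E0: "err n s * p1 s \<ge> 0" using err_nonneg[OF n1 s0] by simp
  \<comment> \<open>The first node strictly to the right of $s$, whether or not it is at most $n$.\<close>
  define j where "j = nat \<lfloor>(s * r ^ 9 + real n) / 2\<rfloor> + 1"
  have j: "2 * real j - 2 \<le> s * r ^ 9 + real n" "s * r ^ 9 + real n < 2 * real j"
  proof -
    have nn: "\<lfloor>(s * r ^ 9 + real n) / 2\<rfloor> \<ge> 0" using s0 r by simp
    have "real j = of_int \<lfloor>(s * r ^ 9 + real n) / 2\<rfloor> + 1" using nn by (simp add: j_def)
    moreover have "of_int \<lfloor>y\<rfloor> \<le> y \<and> y < of_int \<lfloor>y\<rfloor> + 1" for y :: real by linarith
    ultimately have "real j - 1 \<le> (s * r ^ 9 + real n) / 2" "(s * r ^ 9 + real n) / 2 < real j"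
      by (metis add_diff_cancel_right')+
    then show "2 * real j - 2 \<le> s * r ^ 9 + real n" "s * r ^ 9 + real n < 2 * real j" by auto
  qed
  have cell: "s \<in> {node n j - mesh n..<node n j}"
    using j unfolding cell_iff[OF n1] r_def[symmetric] by simp
  have "\<bar>step_fun n x s - phi n s\<bar> \<le> step_const * err n s * p1 s"
  proof (cases "j \<le> n")
    case jn: True
    define t where "t = node n j"
    have t: "s < t" "t \<le> s + mesh n" using cell by (auto simp: t_def)
    have "node n j \<ge> 0" using t s0 by (simp add: t_def)
    then have "\<bar>cw_term n j / cw_term n (mid n) - phi n t\<bar> \<le> local_const * ((1 + t ^ 12) / cw_scale n ^ 12) * p1 t"
      using local_limit[OF n jn] by (simp add: t_def)
    also have "\<dots> \<le> local_const * (531442 * err n s) * p1 s"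
    proof (intro mult_mono mult_left_mono)
      have "t \<le> s + 2" using t mesh_bounds[OF n1] by simp
      then have "t ^ 12 \<le> (s + 2) ^ 12" using t s0 by (intro power_mono) auto
      then have "(1 + t ^ 12) / cw_scale n ^ 12 \<le> (1 + (s + 2) ^ 12) / cw_scale n ^ 12"
        using r by (intro divide_right_mono) (auto simp: r_def)
      also have "\<dots> \<le> 531442 * err n s" by (rule power12_shift_le[OF n1 s0])
      finally show "(1 + t ^ 12) / cw_scale n ^ 12 \<le> 531442 * err n s" .
      show "p1 t \<le> p1 s" using t s0 by (intro p1_antimono) auto
    qed (use local_const_ge err_nonneg[OF n1 s0] in auto)
    finally have 1: "\<bar>cw_term n j / cw_term n (mid n) - phi n t\<bar> \<le> 531442 * local_const * (err n s * p1 s)"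
      by (simp add: mult_ac)
    have 2: "\<bar>phi n t - phi n s\<bar> \<le> 10 * 531442 * (err n s * p1 s)"
      using phi_variation[OF n1 s0 t] by (simp add: mult_ac)
    have "step_fun n x s = cw_term n j / cw_term n (mid n)"
      by (rule step_fun_eq[OF n1 jn _ cell]) (use t True in \<open>simp add: t_def\<close>)
    then have "\<bar>step_fun n x s - phi n s\<bar> \<le> 531442 * local_const * (err n s * p1 s) + 10 * 531442 * (err n s * p1 s)"
      using 1 2 by linarith
    also have "\<dots> \<le> step_const * (err n s * p1 s)"
      unfolding step_const_def distrib_right using E0 by linarith
    finally show ?thesis by (simp add: mult_ac)
  next
    case False
    have "step_fun n x s = 0"
    proof (rule step_fun_eq_0)
      fix i assume "i \<le> n"
      then have "real i \<le> real j - 1" using False by linarith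
      then have "\<not> (s * r ^ 9 + real n < 2 * real i)" using j(1) by linarith
      then show "s \<notin> {node n i - mesh n..<node n i}"
        unfolding cell_iff[OF n1] r_def[symmetric] by simp
    qed
    moreover have "cw_scale n \<le> s"
    proof -
      have "real n \<le> real j - 1" using False by linarith
      then have "real n \<le> s * r ^ 9" using j(1) by linarith
      moreover have "r ^ 3 * r ^ 9 = real n" using r(2) by (simp flip: power_add)
      ultimately have "r ^ 3 * r ^ 9 \<le> s * r ^ 9" by simp
      then have "r ^ 3 \<le> s" by (rule mult_right_le_imp_le) (use r(1) in simp)
      moreover have "r ^ 1 \<le> r ^ 3" using r(1) by (intro power_increasing) auto
      ultimately show ?thesis by (simp add: r_def)
    qed
    ultimately have "\<bar>step_fun n x s - phi n s\<bar> \<le> 2 * (s ^ 12 / cw_scale n ^ 12) * p1 s"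
      using phi_beyond_scale(2)[OF n1, of s] by simp
    also have "\<dots> \<le> 2 * err n s * p1 s"
      unfolding err_def using r(1) by (intro mult_left_mono mult_right_mono divide_right_mono) (auto simp: r_def)
    also have "\<dots> = 2 * (err n s * p1 s)" by simp
    also have "\<dots> \<le> step_const * (err n s * p1 s)"
      using local_const_ge by (intro mult_right_mono[OF _ E0]) (simp add: step_const_def)
    finally show ?thesis by (simp add: mult_ac)
  qed
  moreover have "0 \<le> exp 6 * p1 x * indicator {x - mesh n..x} s" by simp
  moreover have i1: "indicator {x..} s = (1::real)" using True by simp
  ultimately show ?thesis unfolding i1 mult_1 by linarith
next
  case False
  have n1: "n \<ge> 1" using n by simp
  have "\<bar>step_fun n x s\<bar> \<le> exp 6 * p1 x * indicator {x - mesh n..x} s"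
  proof (cases "\<exists>j\<le>n. x < node n j \<and> s \<in> {node n j - mesh n..<node n j}")
    case True
    then obtain j where j: "j \<le> n" "x < node n j" "s \<in> {node n j - mesh n..<node n j}" by blast
    have "step_fun n x s = cw_term n j / cw_term n (mid n)" by (rule step_fun_eq[OF n1 j])
    moreover have "0 \<le> cw_term n j / cw_term n (mid n)" by (simp add: cw_term_def)
    moreover have "cw_term n j / cw_term n (mid n) \<le> exp 6 * p1 (node n j)"
      using node_weight_upper[OF n1 j(1)] j x by simp
    moreover have "exp 6 * p1 (node n j) \<le> exp 6 * p1 x"
      using p1_antimono[of x "node n j"] j x by simp
    ultimately have "\<bar>step_fun n x s\<bar> \<le> exp 6 * p1 x" by linarith
    moreover have "s \<in> {x - mesh n..x}" using j False by auto
    ultimately show ?thesis by simp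
  next
    case no: False
    then have "step_fun n x s = 0" by (intro step_fun_eq_0) auto
    then show ?thesis by simp
  qed
  then show ?thesis using False by simp
qed

text \<open>The tail sum in units of the central weight, multiplied by the mesh so that it is the integral of
the step function.\<close>

definition scaled_tail :: "nat \<Rightarrow> real \<Rightarrow> real" where
  "scaled_tail n x = (\<Sum>j | j \<le> n \<and> x < node n j. cw_term n j / cw_term n (mid n)) * mesh n"

lemma step_fun_integral:
  assumes "n \<ge> 1"
  shows "integrable lborel (step_fun n x)" "(LBINT s. step_fun n x s) = scaled_tail n x"
proof -
  have m: "mesh n > 0" using mesh_bounds[OF assms] by simp
  then have i: "integrable lborel (\<lambda>s. cw_term n j / cw_term n (mid n) * indicator {node n j - mesh n..<node n j} s)" for j
    by (intro integrable_mult_right) auto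
  show "integrable lborel (step_fun n x)"
    unfolding step_fun_def[abs_def] by (intro Bochner_Integration.integrable_sum i)
  show "(LBINT s. step_fun n x s) = scaled_tail n x"
    unfolding step_fun_def scaled_tail_def
    using m by (subst Bochner_Integration.integral_sum[OF i]) (simp add: sum_distrib_right)
qed

text \<open>Integrating \<open>step_fun_approx\<close> leaves the 12th tail moment, which \<open>tail_moment_le\<close> bounds in terms of
the tail integral, and one rectangle of height $p_1(x)$, which \<open>p1_le_tail\<close> bounds likewise.\<close>

lemma scaled_tail_approx:
  "\<exists>C\<ge>0. \<forall>n\<ge>64. \<forall>x\<ge>0.
     \<bar>scaled_tail n x - ((LBINT t:{x..}. p1 t) + (LBINT t:{x..}. p2 t) / cw_scale n ^ 6)\<bar>
     \<le> C * err n x * (LBINT t:{x..}. p1 t)"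
proof -
  obtain M where M: "M \<ge> 0" "\<And>x. x \<ge> 0 \<Longrightarrow>
      (LBINT t:{x..}. t ^ 12 * p1 t) \<le> M * (1 + x ^ 12) * (LBINT t:{x..}. p1 t)"
    using tail_moment_le[of 12] by blast
  define C where "C = step_const * (M + 1) + exp 7 * (2 * 531442)"
  have sc: "step_const \<ge> 0" using local_const_ge by (simp add: step_const_def)
  show ?thesis
  proof (intro exI[of _ C] conjI allI impI)
    show "C \<ge> 0" using sc M(1) by (simp add: C_def)
    fix n x assume n: "(64::nat) \<le> n" and x: "(0::real) \<le> x"
    have n1: "n \<ge> 1" using n by simp
    define r where "r = cw_scale n"
    have r: "r \<ge> 1" using cw_scale_powers(1)[OF n1] by (simp add: r_def)
    define T where "T = (LBINT t:{x..}. p1 t)"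
    have T: "T > 0" using tail_p1_pos by (simp add: T_def)
    let ?i = "indicator {x..} :: real \<Rightarrow> real"
    have ip1: "integrable lborel (\<lambda>s. ?i s * p1 s)"
      using set_integrable_p1[of "{x..}"] by (simp add: set_integrable_def)
    have ip2: "integrable lborel (\<lambda>s. ?i s * p2 s)"
      using set_integrable_p2[of "{x..}"] by (simp add: set_integrable_def)
    have ip12: "integrable lborel (\<lambda>s. ?i s * (s ^ 12 * p1 s))"
      using set_integrable_power_p1[of "{x..}" 12] by (simp add: set_integrable_def)
    have phi_split: "?i s * phi n s = ?i s * p1 s + ?i s * p2 s / r ^ 6" for s
      by (simp add: phi_def r_def distrib_left)
    have iphi: "integrable lborel (\<lambda>s. ?i s * phi n s)"
      unfolding phi_split using ip1 ip2 by simp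
    have phi_int: "(LBINT s. ?i s * phi n s) = T + (LBINT t:{x..}. p2 t) / r ^ 6"
      unfolding phi_split using ip1 ip2 by (simp add: T_def set_lebesgue_integral_def)
    have err_split: "?i s * (step_const * err n s * p1 s)
        = step_const / r ^ 12 * (?i s * (s ^ 12 * p1 s)) + step_const * r ^ 4 / r ^ 12 * (?i s * p1 s)" for s
      by (simp add: err_def r_def[symmetric] add_divide_distrib algebra_simps)
    have ierr: "integrable lborel (\<lambda>s. ?i s * (step_const * err n s * p1 s))"
      unfolding err_split using ip1 ip12 by (intro Bochner_Integration.integrable_add integrable_mult_right)
    have err_int: "(LBINT s. ?i s * (step_const * err n s * p1 s))
        = step_const / r ^ 12 * (LBINT t:{x..}. t ^ 12 * p1 t) + step_const * r ^ 4 / r ^ 12 * T"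
      unfolding err_split using ip1 ip12
      by (subst Bochner_Integration.integral_add) (auto simp: T_def set_lebesgue_integral_def)
    have m: "mesh n > 0" "mesh n = 2 / r ^ 9" using mesh_bounds[OF n1] by (simp_all add: mesh_def r_def)
    have icell: "integrable lborel (\<lambda>s. exp 6 * p1 x * indicator {x - mesh n..x} s)"
      using m by (intro integrable_mult_right) auto
    have cell_int: "(LBINT s. exp 6 * p1 x * indicator {x - mesh n..x} s) = exp 6 * p1 x * mesh n"
      using m by simp
    have "\<bar>scaled_tail n x - (T + (LBINT t:{x..}. p2 t) / r ^ 6)\<bar>
        = norm (LBINT s. step_fun n x s - ?i s * phi n s)"
      using step_fun_integral[OF n1] iphi phi_int by (subst Bochner_Integration.integral_diff) auto
    also have "\<dots> \<le> (LBINT s. ?i s * (step_const * err n s * p1 s) + exp 6 * p1 x * indicator {x - mesh n..x} s)"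
    proof (rule Bochner_Integration.integral_norm_bound_integral)
      show "integrable lborel (\<lambda>s. step_fun n x s - ?i s * phi n s)"
        using step_fun_integral(1)[OF n1] iphi by (intro Bochner_Integration.integrable_diff)
      show "integrable lborel (\<lambda>s. ?i s * (step_const * err n s * p1 s) + exp 6 * p1 x * indicator {x - mesh n..x} s)"
        using ierr icell by (rule Bochner_Integration.integrable_add)
      fix s
      show "norm (step_fun n x s - ?i s * phi n s)
        \<le> ?i s * (step_const * err n s * p1 s) + exp 6 * p1 x * indicator {x - mesh n..x} s"
        using step_fun_approx[OF n x, of s] by simp
    qed
    also have "\<dots> = step_const / r ^ 12 * (LBINT t:{x..}. t ^ 12 * p1 t) + step_const * r ^ 4 / r ^ 12 * T
       + exp 6 * p1 x * mesh n"
      by (simp only: Bochner_Integration.integral_add[OF ierr icell] err_int cell_int)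
    also have "\<dots> \<le> step_const / r ^ 12 * (M * (1 + x ^ 12) * T) + step_const * r ^ 4 / r ^ 12 * T
       + exp 6 * (exp 1 * (1 + x) ^ 3 * T) * mesh n"
      using M(2)[OF x] p1_le_tail[OF x] sc r m unfolding T_def
      by (intro add_mono mult_left_mono mult_right_mono) auto
    also have "\<dots> = (step_const * ((M * (1 + x ^ 12) + r ^ 4) / r ^ 12) + exp 7 * (2 * ((1 + x) ^ 3 / r ^ 9))) * T"
    proof -
      have "exp 6 * exp 1 = exp (7::real)" by (simp flip: exp_add)
      then show ?thesis unfolding m(2) by (simp add: add_divide_distrib algebra_simps)
    qed
    also have "\<dots> \<le> (step_const * ((M + 1) * err n x) + exp 7 * (2 * (531442 * err n x))) * T"
    proof (intro mult_right_mono add_mono mult_left_mono)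
      have r4: "1 \<le> r ^ 4" using r by (rule one_le_power)
      have "M * (1 + x ^ 12) \<le> M * (x ^ 12 + r ^ 4)" using M(1) r4 by (intro mult_left_mono) auto
      moreover have "0 \<le> x ^ 12" using x by simp
      ultimately have "M * (1 + x ^ 12) + r ^ 4 \<le> (M + 1) * (x ^ 12 + r ^ 4)"
        unfolding distrib_right[of M 1] mult_1 by linarith
      then have "(M * (1 + x ^ 12) + r ^ 4) / r ^ 12 \<le> (M + 1) * (x ^ 12 + r ^ 4) / r ^ 12"
        using r by (intro divide_right_mono) auto
      then show "(M * (1 + x ^ 12) + r ^ 4) / r ^ 12 \<le> (M + 1) * err n x"
        by (simp add: err_def r_def)
      have "(1 + x) ^ 3 \<le> (x + 2) ^ 3" using x by (intro power_mono) auto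
      then have "(1 + x) ^ 3 / r ^ 9 \<le> (x + 2) ^ 3 / r ^ 9" using r by (intro divide_right_mono) auto
      also have "\<dots> \<le> ((x + 2) ^ 12 + r ^ 4) / r ^ 12"
        using cube_mesh_le[OF n1, of "x + 2"] x by (simp add: r_def)
      also have "\<dots> \<le> 531442 * err n x"
        using power12_shift_le(2)[OF n1 x] by (simp add: r_def)
      finally show "(1 + x) ^ 3 / r ^ 9 \<le> 531442 * err n x" .
    qed (use sc T in auto)
    also have "\<dots> = C * err n x * T" by (simp add: C_def algebra_simps)
    finally show "\<bar>scaled_tail n x - ((LBINT t:{x..}. p1 t) + (LBINT t:{x..}. p2 t) / cw_scale n ^ 6)\<bar>
     \<le> C * err n x * (LBINT t:{x..}. p1 t)" by (simp add: T_def r_def)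
  qed
qed

section \<open>The law of the magnetization\<close>

lemma pair_sum_eq:
  fixes \<sigma> :: "nat \<Rightarrow> real"
  shows "2 * (\<Sum>(i, j)\<in>{(i, j). 1 \<le> i \<and> i < j \<and> j \<le> n}. \<sigma> i * \<sigma> j)
    = (\<Sum>i = 1..n. \<sigma> i)\<^sup>2 - (\<Sum>i = 1..n. (\<sigma> i)\<^sup>2)"
proof (induction n)
  case 0
  have "{(i, j). 1 \<le> i \<and> i < j \<and> j \<le> (0::nat)} = {}" by auto
  then show ?case by (simp only:) simp
next
  case (Suc n)
  let ?P = "\<lambda>n. {(i, j). 1 \<le> i \<and> i < j \<and> j \<le> (n::nat)}"
  have fin: "finite (?P n)"
    by (rule finite_subset[of _ "{1..n} \<times> {1..n}"]) auto
  have split: "?P (Suc n) = ?P n \<union> (\<lambda>i. (i, Suc n)) ` {1..n}" by auto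
  have "(\<Sum>(i, j)\<in>?P (Suc n). \<sigma> i * \<sigma> j) = (\<Sum>(i, j)\<in>?P n. \<sigma> i * \<sigma> j)
      + (\<Sum>(i, j)\<in>(\<lambda>i. (i, Suc n)) ` {1..n}. \<sigma> i * \<sigma> j)"
    unfolding split by (rule sum.union_disjoint) (use fin in auto)
  also have "(\<Sum>(i, j)\<in>(\<lambda>i. (i, Suc n)) ` {1..n}. \<sigma> i * \<sigma> j) = (\<Sum>i = 1..n. \<sigma> i) * \<sigma> (Suc n)"
    by (subst sum.reindex) (auto simp: inj_on_def sum_distrib_right)
  finally show ?case using Suc by (simp add: power2_eq_square algebra_simps)
qed

lemma cw_weight_critical:
  assumes "\<sigma> \<in> Omega n" "n \<ge> 1"
  shows "cw_weight 1 0 n \<sigma> = exp ((S n \<sigma>)\<^sup>2 / (2 * real n)) * exp (- 1/2)"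
proof -
  have "(\<sigma> i)\<^sup>2 = 1" if "i \<in> {1..n}" for i
  proof -
    have "\<sigma> i \<in> {-1, 1}" using assms(1) that unfolding Omega_def by (rule PiE_mem)
    then show ?thesis by auto
  qed
  then have "(\<Sum>i = 1..n. (\<sigma> i)\<^sup>2) = real n" by simp
  then have "(\<Sum>(i, j)\<in>{(i, j). 1 \<le> i \<and> i < j \<and> j \<le> n}. \<sigma> i * \<sigma> j) = ((S n \<sigma>)\<^sup>2 - real n) / 2"
    using pair_sum_eq[of \<sigma> n] by (simp add: S_def)
  moreover have "1 / real n * (((S n \<sigma>)\<^sup>2 - real n) / 2) = (S n \<sigma>)\<^sup>2 / (2 * real n) + - 1/2"
    using assms(2) by (simp add: field_simps)
  ultimately show ?thesis
    unfolding cw_weight_def by (simp only: exp_add[symmetric]) simp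
qed

definition spins :: "nat \<Rightarrow> nat set \<Rightarrow> nat \<Rightarrow> real" where
  "spins n A = (\<lambda>i\<in>{1..n}. if i \<in> A then 1 else - 1)"

lemma bij_betw_spins: "bij_betw (spins n) (Pow {1..n}) (Omega n)"
proof (rule bij_betw_byWitness[where f' = "\<lambda>\<sigma>. {i \<in> {1..n}. \<sigma> i = 1}"])
  show "\<forall>A\<in>Pow {1..n}. {i \<in> {1..n}. spins n A i = 1} = A"
    by (auto simp: spins_def split: if_splits)
  show "\<forall>\<sigma>\<in>Omega n. spins n {i \<in> {1..n}. \<sigma> i = 1} = \<sigma>"
  proof
    fix \<sigma> assume \<sigma>: "\<sigma> \<in> Omega n"
    show "spins n {i \<in> {1..n}. \<sigma> i = 1} = \<sigma>"
    proof
      fix i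
      show "spins n {i \<in> {1..n}. \<sigma> i = 1} i = \<sigma> i"
      proof (cases "i \<in> {1..n}")
        case True
        then have "\<sigma> i \<in> {-1, 1}" using \<sigma> unfolding Omega_def by (rule PiE_mem[rotated])
        then show ?thesis using True by (auto simp: spins_def)
      next
        case False
        then have "\<sigma> i = undefined" using \<sigma> unfolding Omega_def by (metis PiE_arb)
        then show ?thesis using False by (simp only: spins_def restrict_apply if_False)
      qed
    qed
  qed
qed (auto simp: spins_def Omega_def split: if_splits)

lemma S_spins:
  assumes "A \<subseteq> {1..n}"
  shows "S n (spins n A) = 2 * real (card A) - real n"
proof -
  have fin: "finite A" using assms finite_subset by blast
  have "S n (spins n A) = (\<Sum>i = 1..n. 2 * of_bool (i \<in> A) - 1)"
    unfolding S_def by (rule sum.cong) (auto simp: spins_def)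
  also have "\<dots> = 2 * (\<Sum>i = 1..n. of_bool (i \<in> A)) - real n"
    by (simp add: sum_subtractf sum_distrib_left)
  also have "(\<Sum>i = 1..n. of_bool (i \<in> A)) = real (card ({1..n} \<inter> A))"
    by (simp add: sum.inter_restrict[symmetric] of_bool_def)
  also have "{1..n} \<inter> A = A" using assms by auto
  finally show ?thesis .
qed

lemma sum_Omega_by_magnetization:
  "(\<Sum>\<sigma>\<in>Omega n. g (S n \<sigma>)) = (\<Sum>j\<le>n. real (n choose j) * g (2 * real j - real n))"
proof -
  have "(\<Sum>\<sigma>\<in>Omega n. g (S n \<sigma>)) = (\<Sum>A\<in>Pow {1..n}. g (S n (spins n A)))"
    by (rule sum.reindex_bij_betw[OF bij_betw_spins, symmetric])
  also have "\<dots> = (\<Sum>A\<in>Pow {1..n}. g (2 * real (card A) - real n))"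
    by (rule sum.cong) (auto simp: S_spins)
  also have "\<dots> = (\<Sum>j\<le>n. \<Sum>A | A \<in> Pow {1..n} \<and> card A = j. g (2 * real (card A) - real n))"
  proof (rule sum.group[symmetric])
    show "card ` Pow {1..n} \<subseteq> {..n}"
      using card_mono[of "{1..n}"] by fastforce
  qed auto
  also have "\<dots> = (\<Sum>j\<le>n. real (n choose j) * g (2 * real j - real n))"
  proof (rule sum.cong)
    fix j
    have "(\<Sum>A | A \<in> Pow {1..n} \<and> card A = j. g (2 * real (card A) - real n))
        = (\<Sum>A | A \<subseteq> {1..n} \<and> card A = j. g (2 * real j - real n))"
      by (rule sum.cong) auto
    then show "(\<Sum>A | A \<in> Pow {1..n} \<and> card A = j. g (2 * real (card A) - real n))
        = real (n choose j) * g (2 * real j - real n)"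
      by (simp add: n_subsets)
  qed simp
  finally show ?thesis .
qed

lemma measure_curie_weiss:
  assumes "X \<subseteq> Omega n"
  shows "measure (curie_weiss \<beta> h n) X = (\<Sum>\<sigma>\<in>X. cw_weight \<beta> h n \<sigma>) / cw_Z \<beta> h n"
proof -
  have nn: "0 \<le> cw_weight \<beta> h n \<sigma> / cw_Z \<beta> h n" for \<sigma>
    using cw_Z_pos[of \<beta> h n] by (simp add: cw_weight_def)
  have "emeasure (curie_weiss \<beta> h n) X = ennreal (\<Sum>\<sigma>\<in>X. cw_weight \<beta> h n \<sigma> / cw_Z \<beta> h n)"
    unfolding curie_weiss_def using assms nn
    by (subst emeasure_point_measure_finite) (auto simp: finite_Omega sum_ennreal)
  then have "measure (curie_weiss \<beta> h n) X = (\<Sum>\<sigma>\<in>X. cw_weight \<beta> h n \<sigma> / cw_Z \<beta> h n)"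
    unfolding measure_def using nn by (simp add: sum_nonneg)
  then show ?thesis by (simp add: sum_divide_distrib)
qed

text \<open>The factor $e^{-1/2}$ is common to all weights and drops out of the quotient.\<close>

lemma W_tail_probability:
  assumes n: "n \<ge> 1"
  shows "measure (curie_weiss 1 0 n) {\<sigma> \<in> Omega n. W n \<sigma> > x}
    = (\<Sum>j | j \<le> n \<and> x < node n j. cw_term n j) / (\<Sum>j\<le>n. cw_term n j)"
proof -
  have W_eq: "W n \<sigma> = S n \<sigma> / cw_scale n ^ 9" for \<sigma>
    using cw_scale_powers(4)[OF n] by (simp add: W_def)
  have c: "(\<Sum>\<sigma>\<in>{\<sigma> \<in> Omega n. Q (S n \<sigma>)}. cw_weight 1 0 n \<sigma>)
     = (\<Sum>j | j \<le> n \<and> Q (2 * real j - real n). cw_term n j) * exp (- 1/2)" for Q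
  proof -
    have "(\<Sum>\<sigma>\<in>{\<sigma> \<in> Omega n. Q (S n \<sigma>)}. cw_weight 1 0 n \<sigma>)
       = (\<Sum>\<sigma>\<in>Omega n. if Q (S n \<sigma>) then cw_weight 1 0 n \<sigma> else 0)"
      by (rule sum.inter_filter[OF finite_Omega])
    also have "\<dots> = (\<Sum>\<sigma>\<in>Omega n. if Q (S n \<sigma>) then exp ((S n \<sigma>)\<^sup>2 / (2 * real n)) * exp (- 1/2) else 0)"
      using cw_weight_critical n by (intro sum.cong) auto
    also have "\<dots> = (\<Sum>j\<le>n. real (n choose j) * (if Q (2 * real j - real n)
        then exp ((2 * real j - real n)\<^sup>2 / (2 * real n)) * exp (- 1/2) else 0))"
      by (rule sum_Omega_by_magnetization)
    also have "\<dots> = (\<Sum>j\<in>{..n}. if Q (2 * real j - real n) then cw_term n j * exp (- 1/2) else 0)"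
      by (rule sum.cong) (auto simp: cw_term_def)
    also have "\<dots> = (\<Sum>j\<in>{j\<in>{..n}. Q (2 * real j - real n)}. cw_term n j * exp (- 1/2))"
      by (rule sum.inter_filter[symmetric]) simp
    also have "\<dots> = (\<Sum>j | j \<le> n \<and> Q (2 * real j - real n). cw_term n j) * exp (- 1/2)"
      by (simp add: sum_distrib_right)
    finally show ?thesis .
  qed
  have "cw_Z 1 0 n = (\<Sum>j\<le>n. cw_term n j) * exp (- 1/2)"
    using c[of "\<lambda>_. True"] by (simp add: cw_Z_def atMost_def)
  moreover have "(\<Sum>\<sigma>\<in>{\<sigma> \<in> Omega n. W n \<sigma> > x}. cw_weight 1 0 n \<sigma>)
      = (\<Sum>j | j \<le> n \<and> x < node n j. cw_term n j) * exp (- 1/2)"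
    using c[of "\<lambda>s. s / cw_scale n ^ 9 > x"] by (simp add: W_eq node_def)
  ultimately show ?thesis
    by (subst measure_curie_weiss) auto
qed

text \<open>Flipping all spins maps negative to positive magnetization.  For even \<open>n\<close> there is in
addition the atom at 0, whose scaled weight is the mesh.\<close>

lemma scaled_total:
  assumes n: "n \<ge> 1"
  shows "\<bar>(\<Sum>j\<le>n. cw_term n j) / cw_term n (mid n) * mesh n - 2 * scaled_tail n 0\<bar> \<le> mesh n"
proof -
  define a where "a = cw_term n (mid n)"
  have a: "a > 0" using cw_term_pos[OF mid_le[OF n]] by (simp add: a_def)
  have r: "cw_scale n ^ 9 > 0" using cw_scale_powers(1)[OF n] by simp
  have pos_iff: "0 < node n j \<longleftrightarrow> n < 2 * j" for j
  proof -
    have "0 < node n j \<longleftrightarrow> real n < real (2 * j)" using r by (simp add: node_def zero_less_divide_iff)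
    then show ?thesis unfolding of_nat_less_iff .
  qed
  let ?R = "{j. j \<le> n \<and> n < 2 * j}" and ?L = "{j. j \<le> n \<and> 2 * j < n}" and ?M = "{j. j \<le> n \<and> 2 * j = n}"
  have "{..n} = (?R \<union> ?L) \<union> ?M" by auto
  then have "(\<Sum>j\<le>n. cw_term n j) = (\<Sum>j\<in>(?R \<union> ?L) \<union> ?M. cw_term n j)" by (rule arg_cong)
  also have "\<dots> = (\<Sum>j\<in>?R \<union> ?L. cw_term n j) + (\<Sum>j\<in>?M. cw_term n j)"
    by (rule sum.union_disjoint) auto
  also have "(\<Sum>j\<in>?R \<union> ?L. cw_term n j) = (\<Sum>j\<in>?R. cw_term n j) + (\<Sum>j\<in>?L. cw_term n j)"
    by (rule sum.union_disjoint) auto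
  also have "(\<Sum>j\<in>?L. cw_term n j) = (\<Sum>j\<in>?R. cw_term n j)"
  proof (rule sum.reindex_bij_witness[of _ "\<lambda>j. n - j" "\<lambda>j. n - j"])
    fix j assume j: "j \<in> ?L"
    then have "(2 * real (n - j) - real n)\<^sup>2 = (2 * real j - real n)\<^sup>2"
      by (simp add: of_nat_diff power2_eq_square algebra_simps)
    then show "cw_term n (n - j) = cw_term n j"
      using j by (simp add: cw_term_def binomial_symmetric[of j n])
  qed auto
  finally have tot: "(\<Sum>j\<le>n. cw_term n j) = 2 * (\<Sum>j\<in>?R. cw_term n j) + (\<Sum>j\<in>?M. cw_term n j)" by simp
  have "?M \<subseteq> {mid n}" by (auto simp: mid_def)
  then have "(\<Sum>j\<in>?M. cw_term n j) \<le> (\<Sum>j\<in>{mid n}. cw_term n j)"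
    by (intro sum_mono2) (auto simp: cw_term_def)
  then have M: "(\<Sum>j\<in>?M. cw_term n j) / a \<le> 1" "0 \<le> (\<Sum>j\<in>?M. cw_term n j) / a"
    using a by (auto simp: a_def intro!: divide_nonneg_nonneg sum_nonneg simp: cw_term_def)
  have m: "mesh n > 0" using mesh_bounds[OF n] by simp
  have "(\<Sum>j\<le>n. cw_term n j) / a * mesh n - 2 * scaled_tail n 0 = (\<Sum>j\<in>?M. cw_term n j) / a * mesh n"
    unfolding tot scaled_tail_def pos_iff a_def[symmetric] sum_divide_distrib[symmetric]
    by (simp add: add_divide_distrib distrib_right)
  moreover have "(\<Sum>j\<in>?M. cw_term n j) / a * mesh n \<le> 1 * mesh n" "0 \<le> (\<Sum>j\<in>?M. cw_term n j) / a * mesh n"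
    by (rule mult_right_mono[OF M(1)], use m in simp) (rule mult_nonneg_nonneg[OF M(2)], use m in simp)
  ultimately show ?thesis by (simp add: a_def)
qed

lemma LBINT_even:
  fixes f :: "real \<Rightarrow> real"
  assumes even: "\<And>t. f (- t) = f t" and int: "set_integrable lborel UNIV f"
  shows "(LBINT t. f t) = 2 * (LBINT t:{0..}. f t)"
proof -
  have i: "set_integrable lborel A f" if "A \<in> sets borel" for A
    by (rule set_integrable_subset[OF int]) (use that in auto)
  have "(LBINT t. f t) = (LBINT t:{0..} \<union> {..<0}. f t)"
    unfolding set_lebesgue_integral_def by (rule Bochner_Integration.integral_cong) (auto simp: indicator_def)
  also have "\<dots> = (LBINT t:{0..}. f t) + (LBINT t:{..<0}. f t)"
    by (rule set_integral_Un) (auto intro: i)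
  also have "(LBINT t:{..<0}. f t) = (LBINT t:{0<..}. f t)"
    unfolding set_lebesgue_integral_def
    by (subst lborel_integral_real_affine[of "-1" _ 0]) (auto simp: even indicator_def intro!: Bochner_Integration.integral_cong)
  also have "\<dots> = (LBINT t:{0..}. f t)"
  proof (rule set_integral_null_delta)
    have "({0<..} - {0..}) \<union> ({0..} - {0<..}) = {0::real}" by auto
    then show "({0<..} - {0..}) \<union> ({0..} - {0<..}) \<in> null_sets (lborel :: real measure)"
      by (simp add: finite_imp_null_set_lborel)
    show "integrable lborel f" using int by (simp add: set_integrable_def)
  qed auto
  finally show ?thesis by simp
qed

lemma one_minus_F:
  "1 - F x = (LBINT t:{x..}. p1 t) / (LBINT t. p1 t)"
proof -
  have pos: "(LBINT t. p1 t) > 0"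
    using LBINT_even[of p1] set_integrable_p1[of UNIV] tail_p1_pos[of 0] by (simp add: p1_def)
  have "(LBINT t. p1 t) = (LBINT t:{..x} \<union> {x<..}. p1 t)"
    unfolding set_lebesgue_integral_def by (rule Bochner_Integration.integral_cong) (auto simp: indicator_def)
  also have "\<dots> = (LBINT t:{..x}. p1 t) + (LBINT t:{x<..}. p1 t)"
    by (rule set_integral_Un) (auto intro: set_integrable_p1)
  also have "(LBINT t:{x<..}. p1 t) = (LBINT t:{x..}. p1 t)"
  proof (rule set_integral_null_delta)
    have "({x<..} - {x..}) \<union> ({x..} - {x<..}) = {x}" by auto
    then show "({x<..} - {x..}) \<union> ({x..} - {x<..}) \<in> null_sets lborel"
      by (simp add: finite_imp_null_set_lborel)
    show "integrable lborel p1" using set_integrable_p1[of UNIV] by (simp add: set_integrable_def)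
  qed auto
  finally show ?thesis using pos by (simp add: F_def field_simps)
qed

section \<open>Expansion of the tail ratio\<close>

lemma tail_p2_le:
  "\<exists>C\<ge>0. \<forall>x\<ge>0. \<bar>LBINT t:{x..}. p2 t\<bar> \<le> C * (1 + x ^ 6) * (LBINT t:{x..}. p1 t)"
proof -
  obtain M where M: "M \<ge> 0" "\<And>x. x \<ge> 0 \<Longrightarrow>
      (LBINT t:{x..}. t ^ 6 * p1 t) \<le> M * (1 + x ^ 6) * (LBINT t:{x..}. p1 t)"
    using tail_moment_le[of 6] by blast
  show ?thesis
  proof (intro exI[of _ "1 + M"] conjI allI impI)
    fix x :: real assume x: "x \<ge> 0"
    define T where "T = (LBINT t:{x..}. p1 t)"
    have T: "T > 0" using tail_p1_pos by (simp add: T_def)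
    have i: "set_integrable lborel {x..} p1" "set_integrable lborel {x..} p2"
      "set_integrable lborel {x..} (\<lambda>t. t ^ 6 * p1 t)"
      by (simp_all add: set_integrable_p1 set_integrable_p2 set_integrable_power_p1)
    have b: "\<bar>p2 t\<bar> \<le> p1 t + t ^ 6 * p1 t" if "t \<ge> 0" for t
    proof -
      have "t ^ 2 \<le> 1 + t ^ 6" using that by (intro power_le_one_plus_power) auto
      moreover have "0 \<le> t ^ 6" "0 \<le> t ^ 2" by simp_all
      ultimately have "\<bar>t ^ 2 / 2 - t ^ 6 / 30\<bar> \<le> 1 + t ^ 6" by (intro abs_leI) argo+
      then have "\<bar>t ^ 2 / 2 - t ^ 6 / 30\<bar> * p1 t \<le> (1 + t ^ 6) * p1 t" by (rule mult_right_mono) simp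
      then show ?thesis by (simp add: p2_def p1_def abs_mult distrib_right)
    qed
    have "(LBINT t:{x..}. p2 t) \<le> (LBINT t:{x..}. p1 t + t ^ 6 * p1 t)"
      using b x by (intro set_integral_mono set_integral_add(1) i) (auto simp: abs_le_iff)
    moreover have "(LBINT t:{x..}. - p2 t) \<le> (LBINT t:{x..}. p1 t + t ^ 6 * p1 t)"
      using b x i(2) by (intro set_integral_mono set_integral_add(1) i) (auto simp: abs_le_iff set_integrable_def)
    ultimately have "\<bar>LBINT t:{x..}. p2 t\<bar> \<le> (LBINT t:{x..}. p1 t + t ^ 6 * p1 t)"
      using set_integral_uminus[OF i(2)] by simp
    also have "\<dots> = T + (LBINT t:{x..}. t ^ 6 * p1 t)"
      using set_integral_add(2)[OF i(1,3)] by (simp add: T_def)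
    also have "\<dots> \<le> 1 * (1 + x ^ 6) * T + M * (1 + x ^ 6) * T"
      using M(2)[OF x] T x by (intro add_mono) (auto simp: T_def)
    finally show "\<bar>LBINT t:{x..}. p2 t\<bar> \<le> (1 + M) * (1 + x ^ 6) * (LBINT t:{x..}. p1 t)"
      by (simp add: T_def distrib_right)
  qed (use M in simp)
qed

text \<open>The numerator minus the denominator equals the denominator times $(\rho-\rho_0)h$, up to the errors
and a product of two small quantities.\<close>

lemma ratio_expansion:
  fixes e1 e2 \<rho> \<rho>0 h :: real
  defines "N \<equiv> 1 + \<rho> * h + e1" and "D \<equiv> 1 + \<rho>0 * h + e2"
  assumes D: "1/2 \<le> D"
  shows "\<bar>N / D - 1 - (\<rho> - \<rho>0) * h\<bar> \<le> 2 * (\<bar>e1\<bar> + \<bar>e2\<bar> + \<bar>\<rho>0 * h + e2\<bar> * \<bar>(\<rho> - \<rho>0) * h\<bar>)"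
proof -
  define X where "X = e1 - e2 - (\<rho>0 * h + e2) * ((\<rho> - \<rho>0) * h)"
  have "N - D - D * ((\<rho> - \<rho>0) * h) = X"
    by (simp add: N_def D_def X_def algebra_simps)
  then have "N / D - 1 - (\<rho> - \<rho>0) * h = X / D"
    using D by (simp add: field_simps)
  then have "\<bar>N / D - 1 - (\<rho> - \<rho>0) * h\<bar> = \<bar>X\<bar> / D" using D by simp
  also have "\<dots> \<le> \<bar>X\<bar> / (1/2)" using D by (intro divide_left_mono) auto
  also have "\<bar>X\<bar> \<le> \<bar>e1\<bar> + \<bar>e2\<bar> + \<bar>(\<rho>0 * h + e2) * ((\<rho> - \<rho>0) * h)\<bar>"
    unfolding X_def by linarith
  finally show ?thesis by (simp add: abs_mult)
qed

theorem theorem1p4: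
  "\<exists>C > 0. \<forall>\<^sub>F n in sequentially. \<forall>x::real. 0 \<le> x \<and> x \<le> real n powr (1 / 12) \<longrightarrow>
     \<bar>measure (curie_weiss 1 0 n) {\<sigma> \<in> Omega n. W n \<sigma> > x} / (1 - F x)
        - 1 - G x / sqrt (real n)\<bar>
     \<le> C * (x ^ 12 + real n powr (1 / 3)) / real n"
proof -
  define T where "T = (\<lambda>x. LBINT t:{x..}. p1 t)"
  define \<rho> where "\<rho> = (\<lambda>x. (LBINT t:{x..}. p2 t) / T x)"
  have T: "T x > 0" for x using tail_p1_pos by (simp add: T_def)
  obtain C1 where C1: "C1 \<ge> 0" "\<And>n x. n \<ge> 64 \<Longrightarrow> x \<ge> 0 \<Longrightarrow>
     \<bar>scaled_tail n x - (T x + (LBINT t:{x..}. p2 t) / cw_scale n ^ 6)\<bar> \<le> C1 * err n x * T x"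
    using scaled_tail_approx unfolding T_def by blast
  obtain R where R: "R \<ge> 0" "\<And>x. x \<ge> 0 \<Longrightarrow> \<bar>LBINT t:{x..}. p2 t\<bar> \<le> R * (1 + x ^ 6) * T x"
    using tail_p2_le unfolding T_def by blast
  have \<rho>_bound: "\<bar>\<rho> x\<bar> \<le> R * (1 + x ^ 6)" if "x \<ge> 0" for x
    using R(2)[OF that] T[of x] by (simp add: \<rho>_def divide_le_eq)
  define C2 where "C2 = C1 + 1 / T 0"
  define K where "K = \<bar>\<rho> 0\<bar> + C2"
  define C where "C = 2 * (C1 + C2 + K * (2 * R + \<bar>\<rho> 0\<bar>)) + 1"
  have C2: "C2 \<ge> 0" using C1(1) T[of 0] by (simp add: C2_def)
  have K: "K \<ge> 0" using C2 by (simp add: K_def)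
  have C: "C > 0" using C1(1) C2 K R(1) by (simp add: C_def add_nonneg_pos)
  \<comment> \<open>From \<open>n0\<close> on, the normalized partition function $1+\rho_0h+e_2$ is at least $1/2$.\<close>
  define n0 where "n0 = max 64 (nat \<lceil>(2 * K) ^ 2\<rceil>)"
  have p1_even: "(LBINT t. p1 t) = 2 * T 0"
    unfolding T_def by (rule LBINT_even[OF _ set_integrable_p1]) (simp_all add: p1_def)
  have p2_even: "(LBINT t. p2 t) = 2 * (LBINT t:{0..}. p2 t)"
    by (rule LBINT_even[OF _ set_integrable_p2]) (simp_all add: p2_def)
  have F_eq: "1 - F x = T x / (2 * T 0)" for x
    using one_minus_F[of x] p1_even by (simp add: T_def)
  have G_eq: "G x = \<rho> x - \<rho> 0" for x
    using p1_even p2_even by (simp add: G_def \<rho>_def T_def)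
  have main: "\<bar>measure (curie_weiss 1 0 n) {\<sigma> \<in> Omega n. W n \<sigma> > x} / (1 - F x)
        - 1 - G x / sqrt (real n)\<bar> \<le> C * (x ^ 12 + real n powr (1 / 3)) / real n"
    if n: "n \<ge> n0" and x: "0 \<le> x" for n x
  proof -
    have n64: "n \<ge> 64" and n1: "n \<ge> 1" using n by (auto simp: n0_def)
    define r where "r = cw_scale n"
    have r: "r \<ge> 1" "r ^ 12 = real n" "r ^ 4 = real n powr (1 / 3)" "r ^ 6 = sqrt (real n)"
      using cw_scale_powers[OF n1] by (simp_all add: r_def)
    define h where "h = 1 / r ^ 6"
    have h0: "h \<ge> 0" using r by (simp add: h_def)
    have Kh: "K * h \<le> 1/2"
    proof -
      have "(2 * K) ^ 2 \<le> real n0" by (simp add: n0_def le_max_iff_disj) linarith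
      then have "2 * K \<le> sqrt (real n)" using n by (intro real_le_rsqrt) simp
      then show ?thesis using r(1) by (simp add: h_def r(4)[symmetric] field_simps)
    qed
    have err0: "err n 0 \<le> h" "err n 0 \<le> err n x" "mesh n \<le> 2 * err n 0"
    proof -
      have e0: "err n 0 = 1 / r ^ 8"
        using r(1) by (simp add: err_def r_def[symmetric] field_simps flip: power_add)
      show "err n 0 \<le> h" unfolding e0 h_def using r(1) by (intro divide_left_mono power_increasing) auto
      have "1 / r ^ 9 \<le> 1 / r ^ 8" using r(1) by (intro divide_left_mono power_increasing) auto
      then show "mesh n \<le> 2 * err n 0" unfolding e0 by (simp add: mesh_def r_def)
      show "err n 0 \<le> err n x" unfolding err_def using x r(1) by (intro divide_right_mono) (auto simp: r_def)
    qed
    have err_h: "h * h * (1 + x ^ 12) \<le> err n x"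
    proof -
      have "1 + x ^ 12 \<le> x ^ 12 + r ^ 4" using one_le_power[OF r(1), of 4] by linarith
      then have "(1 + x ^ 12) / r ^ 12 \<le> err n x"
        unfolding err_def r_def[symmetric] using r(1) by (intro divide_right_mono) auto
      then show ?thesis by (simp add: h_def flip: power_add)
    qed
    define Zn where "Zn = (\<Sum>j\<le>n. cw_term n j) / cw_term n (mid n) * mesh n"
    define e1 where "e1 = scaled_tail n x / T x - 1 - \<rho> x * h"
    define e2 where "e2 = Zn / (2 * T 0) - 1 - \<rho> 0 * h"
    have mult_T: "T y * (1 + \<rho> y * h) = T y + (LBINT t:{y..}. p2 t) / cw_scale n ^ 6" for y
      using T[of y] by (simp add: \<rho>_def h_def r_def distrib_left)
    have e1: "\<bar>e1\<bar> \<le> C1 * err n x"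
    proof -
      have "\<bar>T x * e1\<bar> \<le> C1 * err n x * T x"
        using C1(2)[OF n64 x] mult_T[of x] T[of x] by (simp add: e1_def right_diff_distrib distrib_left algebra_simps)
      then have "T x * \<bar>e1\<bar> \<le> T x * (C1 * err n x)" using T[of x] by (simp add: abs_mult mult_ac)
      then show ?thesis using T[of x] by simp
    qed
    \<comment> \<open>Both the tail sum at 0 and the central atom, of size $2n^{-3/4}$, contribute here.\<close>
    have e2: "\<bar>e2\<bar> \<le> C2 * err n 0"
    proof -
      have "2 * T 0 * e2 = Zn - 2 * (T 0 * (1 + \<rho> 0 * h))"
        using T[of 0] by (simp add: e2_def algebra_simps)
      then have decomp: "2 * T 0 * e2 = (Zn - 2 * scaled_tail n 0)
         + 2 * (scaled_tail n 0 - (T 0 + (LBINT t:{0..}. p2 t) / cw_scale n ^ 6))"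
        unfolding mult_T by simp
      have "\<bar>2 * T 0 * e2\<bar> \<le> 2 * err n 0 + 2 * (C1 * err n 0 * T 0)"
      proof -
        have "\<bar>y\<bar> \<le> 2 * e + 2 * c" if "y = u + 2 * v" "\<bar>u\<bar> \<le> mesh n" "\<bar>v\<bar> \<le> c" "mesh n \<le> 2 * e"
          for y u v c e :: real
          using that by linarith
        from this[OF _ scaled_total[OF n1, folded Zn_def] C1(2)[OF n64 order_refl] err0(3)]
        show ?thesis using decomp by blast
      qed
      also have "\<dots> = 2 * T 0 * (C2 * err n 0)"
        using T[of 0] by (simp add: C2_def algebra_simps)
      finally have "2 * T 0 * \<bar>e2\<bar> \<le> 2 * T 0 * (C2 * err n 0)"
        using T[of 0] by (simp add: abs_mult)
      then show ?thesis using T[of 0] by simp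
    qed
    have dev: "\<bar>\<rho> 0 * h + e2\<bar> \<le> K * h"
    proof -
      have "C2 * err n 0 \<le> C2 * h" using C2 err0(1) by (rule mult_left_mono[rotated])
      moreover have "\<bar>\<rho> 0 * h\<bar> = \<bar>\<rho> 0\<bar> * h" using h0 by (simp add: abs_mult)
      ultimately show ?thesis using e2 unfolding K_def distrib_right by linarith
    qed
    have Dge: "1/2 \<le> 1 + \<rho> 0 * h + e2" using dev Kh by linarith
    have gap: "\<bar>(\<rho> x - \<rho> 0) * h\<bar> \<le> (2 * R + \<bar>\<rho> 0\<bar>) * (1 + x ^ 12) * h"
    proof -
      have x12: "0 \<le> x ^ 12" using x by simp
      have "x ^ 6 \<le> 1 + x ^ 12" using x by (intro power_le_one_plus_power) auto
      then have "1 + x ^ 6 \<le> 2 * (1 + x ^ 12)" using x12 by argo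
      then have "R * (1 + x ^ 6) \<le> R * (2 * (1 + x ^ 12))" using R(1) by (rule mult_left_mono)
      moreover have "\<bar>\<rho> 0\<bar> * 1 \<le> \<bar>\<rho> 0\<bar> * (1 + x ^ 12)" using x12 by (intro mult_left_mono) auto
      ultimately have "\<bar>\<rho> x - \<rho> 0\<bar> \<le> (2 * R + \<bar>\<rho> 0\<bar>) * (1 + x ^ 12)"
        using \<rho>_bound[OF x] unfolding distrib_right[of "2 * R"] by linarith
      then show ?thesis using h0 by (simp add: abs_mult mult_right_mono)
    qed
    have "\<bar>\<rho> 0 * h + e2\<bar> * \<bar>(\<rho> x - \<rho> 0) * h\<bar> \<le> K * h * ((2 * R + \<bar>\<rho> 0\<bar>) * (1 + x ^ 12) * h)"
      using dev gap K h0 by (intro mult_mono) auto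
    also have "\<dots> = K * (2 * R + \<bar>\<rho> 0\<bar>) * (h * h * (1 + x ^ 12))" by (simp add: mult_ac)
    also have "\<dots> \<le> K * (2 * R + \<bar>\<rho> 0\<bar>) * err n x"
      using K R(1) err_h by (intro mult_left_mono) auto
    finally have cross: "\<bar>\<rho> 0 * h + e2\<bar> * \<bar>(\<rho> x - \<rho> 0) * h\<bar> \<le> K * (2 * R + \<bar>\<rho> 0\<bar>) * err n x" .
    have e2': "\<bar>e2\<bar> \<le> C2 * err n x"
      using e2 mult_left_mono[OF err0(2) C2] by linarith
    have "measure (curie_weiss 1 0 n) {\<sigma> \<in> Omega n. W n \<sigma> > x} = scaled_tail n x / Zn"
    proof -
      have "mesh n > 0" "cw_term n (mid n) > 0"
        using mesh_bounds[OF n1] cw_term_pos[OF mid_le[OF n1]] by auto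
      then show ?thesis
        unfolding W_tail_probability[OF n1] scaled_tail_def Zn_def by (simp flip: sum_divide_distrib)
    qed
    then have "measure (curie_weiss 1 0 n) {\<sigma> \<in> Omega n. W n \<sigma> > x} / (1 - F x)
       = (scaled_tail n x / T x) / (Zn / (2 * T 0))"
      by (simp add: F_eq)
    also have "\<dots> = (1 + \<rho> x * h + e1) / (1 + \<rho> 0 * h + e2)" by (simp add: e1_def e2_def)
    finally have "\<bar>measure (curie_weiss 1 0 n) {\<sigma> \<in> Omega n. W n \<sigma> > x} / (1 - F x) - 1 - G x / sqrt (real n)\<bar>
       = \<bar>(1 + \<rho> x * h + e1) / (1 + \<rho> 0 * h + e2) - 1 - (\<rho> x - \<rho> 0) * h\<bar>"
      by (simp add: G_eq h_def r(4))
    also have "\<dots> \<le> 2 * (\<bar>e1\<bar> + \<bar>e2\<bar> + \<bar>\<rho> 0 * h + e2\<bar> * \<bar>(\<rho> x - \<rho> 0) * h\<bar>)"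
      by (rule ratio_expansion[OF Dge])
    also have "\<dots> \<le> 2 * (C1 * err n x + C2 * err n x + K * (2 * R + \<bar>\<rho> 0\<bar>) * err n x)"
      by (intro mult_left_mono add_mono e1 e2' cross) auto
    also have "\<dots> = (C - 1) * err n x" by (simp add: C_def algebra_simps)
    also have "\<dots> \<le> C * err n x" using err_nonneg[OF n1 x] by (simp add: left_diff_distrib)
    also have "\<dots> = C * (x ^ 12 + real n powr (1 / 3)) / real n"
      by (simp add: err_def r_def[symmetric] r)
    finally show ?thesis .
  qed
  have "\<forall>\<^sub>F n in sequentially. \<forall>x::real. 0 \<le> x \<and> x \<le> real n powr (1 / 12) \<longrightarrow>
     \<bar>measure (curie_weiss 1 0 n) {\<sigma> \<in> Omega n. W n \<sigma> > x} / (1 - F x)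
        - 1 - G x / sqrt (real n)\<bar>
     \<le> C * (x ^ 12 + real n powr (1 / 3)) / real n"
    using eventually_ge_at_top[of n0] by eventually_elim (use main in blast)
  with C show ?thesis by blast
qed

end
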